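(* Let a lattice $\Lambda\subset\mathbb{R}^2$ have the projected invariant $\mathrm{PI}(\Lambda)=(x,y)$, so that $x\in[0,1)$, $y\in[0,1]$, $x+y\leq1$. Then (a) $\mathrm{PC}_2[D_2](\Lambda)=\min\left\{x,\,y,\,\dfrac{1-x-y}{\sqrt2}\right\}$; $\mathrm{PC}_q[D_4](\Lambda)=(x^q+y^q)^{1/q}$ for any $q\in[1,+\infty)$; $\mathrm{PC}_q[D_6](\Lambda)=(x^q+(1-y)^q)^{1/q}$ for any $q\in[1,+\infty)$; (b) $\mathrm{PC}_\infty[D_2](\Lambda)=\min\left\{x,\,y,\,\dfrac{1-x-y}{2}\right\}$; $\mathrm{PC}_\infty[D_4](\Lambda)=x$; $\mathrm{PC}_\infty[D_6](\Lambda)=1-y$; (c) the upper bounds $\mathrm{PC}_2[D_2](\Lambda)\leq\frac{1}{2+\sqrt2}$ and $\mathrm{PC}_\infty[D_2](\Lambda)\leq\frac14$ hold for any $\Lambda$ and are achieved for lattices with $\mathrm{PI}=\left(\frac1{2+\sqrt2},\frac1{2+\sqrt2}\right)$ and $\mathrm{PI}=\left(\frac14,\frac14\right)$, respectively. For $q\in[1,+\infty]$, the bound $\mathrm{PC}_q[D_4](\Lambda)\leq1$ holds for any $\Lambda$ and is achieved for any hexagonal lattice. For $q\in[1,+\infty)$, the upper bound $\mathrm{PC}_q[D_6](\Lambda)<2^{1/q}$ holds for any $\Lambda$ and is approached but not achieved as $x\to1$. The bound $\mathrm{PC}_\infty[D_6](\Lambda)\leq1$ holds for any $\Lambda$ and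 is achieved for any square and rectangular lattice.
   Context: A lattice $\Lambda\subset\mathbb{R}^2$ is the set of all integer linear combinations of a linear basis. A superbase of $\Lambda$ is a triple $\{v_0,v_1,v_2\}$, where $v_1,v_2$ is a basis generating $\Lambda$ and $v_0=-v_1-v_2$; it is obtuse if all $p_{ij}=-v_i\cdot v_j\geq 0$ for $i\neq j$. Every lattice in $\mathbb{R}^2$ has an obtuse superbase. The root invariant $\mathrm{RI}(\Lambda)=(r_{12},r_{01},r_{02})$, $r_{12}\leq r_{01}\leq r_{02}$, is the triple of root products $\sqrt{p_{ij}}$ of an obtuse superbase in increasing order (independent of the choice of obtuse superbase). With $\bar r_{ij}=r_{ij}/(r_{12}+r_{01}+r_{02})$, the projected invariant is $\mathrm{PI}(\Lambda)=(\bar r_{02}-\bar r_{01},\,3\bar r_{12})$. For $G=D_2,D_4,D_6$, let $\mathrm{LIS}[G]$ be the closure (within isometry classes of lattices) of the set of lattices with crystallographic point group $G$. Explicitly, $\mathrm{LIS}[D_2]$ consists of all mirror-symmetric lattices (mapped to themselves by some reflection in a line), $\mathrm{LIS}[D_4]$ of all square lattices (these have $\mathrm{PI}=(0,0)$), and $\mathrm{LIS}[D_6]$ of all hexagonal lattices (these have $\mathrm{PI}=(0,1)$). For $q\in[1,+\infty]$, the projected $G$-chiral distance is $$\mathrm{PC}_q[G](\Lambda)=\min_{\Lambda'\in\mathrm{LIS}[G]}\|\mathrm{PI}(\Lambda)-\mathrm{PI}(\Lambda')\|_q,$$ where $\|\cdot\|_q$ is the Minkowski $\ell_q$ norm on $\mathbb{R}^2$.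 A lattice is rectangular if it has a basis of two orthogonal vectors.
   Formalization: In (b) the printed formula PC_∞[D_4](Λ)=x is replaced by max{x,y}, since it fails when y>x: a hexagonal lattice has PI=(0,1), so x=0, but its distance to (0,0) is 1; for y≤x the two agree. *)

theory Defs
  imports "HOL-Analysis.Analysis" "HOL-Library.Extended_Real"
begin

section \<open>Lattices and obtuse superbases\<close>

definition lattice_basis :: "(real^2) set \<Rightarrow> real^2 \<Rightarrow> real^2 \<Rightarrow> bool" where
  "lattice_basis \<Lambda> v w \<longleftrightarrow>
     v \<noteq> w \<and> independent {v, w} \<and>
     \<Lambda> = {of_int m *\<^sub>R v + of_int n *\<^sub>R w | m n :: int. True}"

definition is_lattice :: "(real^2) set \<Rightarrow> bool" where
  "is_lattice \<Lambda> \<longleftrightarrow> (\<exists>v w. lattice_basis \<Lambda> v w)"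

definition superbase :: "(real^2) set \<Rightarrow> real^2 \<Rightarrow> real^2 \<Rightarrow> real^2 \<Rightarrow> bool" where
  "superbase \<Lambda> v0 v1 v2 \<longleftrightarrow> lattice_basis \<Lambda> v1 v2 \<and> v0 = - v1 - v2"

definition obtuse_superbase :: "(real^2) set \<Rightarrow> real^2 \<Rightarrow> real^2 \<Rightarrow> real^2 \<Rightarrow> bool" where
  "obtuse_superbase \<Lambda> v0 v1 v2 \<longleftrightarrow> superbase \<Lambda> v0 v1 v2 \<and>
     - (v1 \<bullet> v2) \<ge> 0 \<and> - (v0 \<bullet> v1) \<ge> 0 \<and> - (v0 \<bullet> v2) \<ge> 0"

definition rectangular_lattice :: "(real^2) set \<Rightarrow> bool" where
  "rectangular_lattice \<Lambda> \<longleftrightarrow> (\<exists>v w. lattice_basis \<Lambda> v w \<and> v \<bullet> w = 0)"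

definition square_lattice :: "(real^2) set \<Rightarrow> bool" where
  "square_lattice \<Lambda> \<longleftrightarrow> (\<exists>v w. lattice_basis \<Lambda> v w \<and> v \<bullet> w = 0 \<and> norm v = norm w)"

text \<open>The two basis vectors of a hexagonal lattice have equal lengths and form an angle
  of 60 degrees.\<close>

definition hexagonal_lattice :: "(real^2) set \<Rightarrow> bool" where
  "hexagonal_lattice \<Lambda> \<longleftrightarrow>
     (\<exists>v w. lattice_basis \<Lambda> v w \<and> norm v = norm w \<and> v \<bullet> w = norm v * norm w * cos (pi / 3))"

section \<open>Root and projected invariants\<close>

text \<open>The definite description is justified by the existence of an obtuse superbase and by the
  independence of the sorted root products of its choice.\<close>

definition RI :: "(real^2) set \<Rightarrow> real \<times> real \<times> real" where
  "RI \<Lambda> = (THE (r12, r01, r02). \<exists>v0 v1 v2. obtuse_superbase \<Lambda> v0 v1 v2 \<and>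
     [r12, r01, r02] =
       sort [sqrt (- (v1 \<bullet> v2)), sqrt (- (v0 \<bullet> v1)), sqrt (- (v0 \<bullet> v2))])"

definition PI :: "(real^2) set \<Rightarrow> real \<times> real" where
  "PI \<Lambda> = (case RI \<Lambda> of (r12, r01, r02) \<Rightarrow>
     let s = r12 + r01 + r02 in (r02 / s - r01 / s, 3 * (r12 / s)))"

section \<open>Point groups and the subspaces of symmetric lattices\<close>

definition point_group :: "(real^2) set \<Rightarrow> (real^2 \<Rightarrow> real^2) set" where
  "point_group \<Lambda> = {f. orthogonal_transformation f \<and> f ` \<Lambda> = \<Lambda>}"

definition plane_rotation :: "real \<Rightarrow> real^2 \<Rightarrow> real^2" where
  "plane_rotation t v = vector [cos t * v$1 - sin t * v$2, sin t * v$1 + cos t * v$2]"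

text \<open>Reflection in the line through the origin at angle \<open>t\<close> to the first coordinate axis.\<close>

definition plane_reflection :: "real \<Rightarrow> real^2 \<Rightarrow> real^2" where
  "plane_reflection t v =
     vector [cos (2 * t) * v$1 + sin (2 * t) * v$2, sin (2 * t) * v$1 - cos (2 * t) * v$2]"

text \<open>The dihedral group of order \<open>2 * n\<close> having the line at angle \<open>t\<close> among its mirrors.
  As \<open>t\<close> varies, these are all the conjugates of $D_n$ in the orthogonal group.\<close>

definition dihedral_group :: "nat \<Rightarrow> real \<Rightarrow> (real^2 \<Rightarrow> real^2) set" where
  "dihedral_group n t =
     {plane_rotation (2 * pi * real k / real n) | k. k < n} \<union>
     {plane_reflection (t + pi * real k / real n) | k. k < n}"

definition has_point_group_D :: "nat \<Rightarrow> (real^2) set \<Rightarrow> bool" where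
  "has_point_group_D n \<Lambda> \<longleftrightarrow> (\<exists>t. point_group \<Lambda> = dihedral_group n t)"

text \<open>\<open>LIS n\<close> is the closure of the lattices with point group $D_n$. The topology on isometry
  classes of lattices is the quotient topology of the space of bases modulo changes of basis and
  isometries. Both are group actions by homeomorphisms, so the quotient map is open and
  the closure may be computed on bases. As the set of bases whose lattice has point
  group $D_n$ is invariant under both actions, \<open>LIS n\<close> is a union of isometry classes, and it does
  not matter which basis of \<open>\<Lambda>\<close> is used.\<close>

definition LIS :: "nat \<Rightarrow> (real^2) set set" where
  "LIS n = {\<Lambda>. \<exists>v w. lattice_basis \<Lambda> v w \<and>
     (v, w) \<in> closure {(v', w'). \<exists>\<Lambda>'. lattice_basis \<Lambda>' v' w' \<and> has_point_group_D n \<Lambda>'}}"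

section \<open>Projected chiral distances\<close>

definition minkowski_norm :: "ereal \<Rightarrow> real \<times> real \<Rightarrow> real" where
  "minkowski_norm q p =
     (if q = \<infinity> then max \<bar>fst p\<bar> \<bar>snd p\<bar>
      else (\<bar>fst p\<bar> powr real_of_ereal q + \<bar>snd p\<bar> powr real_of_ereal q)
             powr (1 / real_of_ereal q))"

text \<open>\<open>LEAST\<close> rather than \<open>Inf\<close>: the value is a minimum attained by a lattice in \<open>LIS n\<close>.\<close>

definition PC :: "ereal \<Rightarrow> nat \<Rightarrow> (real^2) set \<Rightarrow> real" where
  "PC q n \<Lambda> = (LEAST d. \<exists>\<Lambda>' \<in> LIS n. d = minkowski_norm q (PI \<Lambda> - PI \<Lambda>'))"

end

theory Submission imports Defs begin

text \<open>The vectors of an obtuse superbase are shortest vectors in the three non-zero classes of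
  \<open>\<Lambda>\<close> modulo \<open>2\<Lambda>\<close>. Hence the root products do not depend on the superbase, and an isometry of
  \<open>\<Lambda>\<close> that permutes these classes forces root products to be equal or zero: a quarter turn gives
  \<open>PI = (0, 0)\<close>, a sixth turn \<open>PI = (0, 1)\<close>, and a reflection puts \<open>PI\<close> on the boundary of the
  triangle \<open>x, y \<ge> 0\<close>, \<open>x + y \<le> 1\<close>. A symmetry persists in a limit of lattices because its
  matrix in a basis is integral. Conversely, every point of the triangle except the vertex
  \<open>(1, 0)\<close> is the projected invariant of a lattice, and by the crystallographic restriction a
  mirror-symmetric lattice that is neither square nor hexagonal has point group \<open>D\<^sub>2\<close>. The chiral
  distances are therefore distances to the boundary of the triangle and to two of its vertices;
  the nearest boundary point is never the missing vertex.\<close>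

section \<open>Bases and superbases\<close>

text \<open>For root products \<open>a \<le> b \<le> c\<close> with sum \<open>s\<close> one has
  \<open>x = (c - b) / s\<close>, \<open>y = 3 * a / s\<close> and
  \<open>1 - x - y = 2 * (b - a) / s\<close>. So the sides \<open>y = 0\<close>,
  \<open>x + y = 1\<close>, \<open>x = 0\<close> of the triangle say \<open>a = 0\<close>,
  \<open>a = b\<close>, \<open>b = c\<close>: two vectors of the superbase are orthogonal or equally
  long, which is what a mirror needs. The vertex \<open>(1, 0)\<close> would mean
  \<open>a = b = 0\<close>, and then a superbase vector vanishes. Since \<open>PC\<close> sees a
  lattice only through \<open>PI\<close>, it suffices to know the image of each \<open>LIS n\<close>
  under \<open>PI\<close>. Square and hexagonal lattices have too large a point group for
  \<open>n = 2\<close> and enter \<open>LIS 2\<close> only as limits. The denominators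
  \<open>sqrt 2\<close> and \<open>2\<close> are the norms of the functional \<open>u + v\<close>
  for the Euclidean and the maximum norm. The extremal constants mark the point where the distances
  to the three sides coincide: \<open>2 * c + sqrt 2 * c = 1\<close> and
  \<open>2 * c + 2 * c = 1\<close>.\<close>

definition det2 :: "real^2 \<Rightarrow> real^2 \<Rightarrow> real" where
  "det2 v w = v$1 * w$2 - v$2 * w$1"

lemma vec2_eq_iff: "(v::real^2) = w \<longleftrightarrow> v$1 = w$1 \<and> v$2 = w$2"
  by (simp add: vec_eq_iff forall_2)

lemma inner_vec2: "(v::real^2) \<bullet> w = v$1 * w$1 + v$2 * w$2"
  by (simp add: inner_vec_def sum_2)

lemma independent_pair_iff_det2: "v \<noteq> w \<and> independent {v, w} \<longleftrightarrow> det2 v w \<noteq> 0"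
proof (cases "v = w \<or> w = 0")
  case True
  then show ?thesis by (auto simp: det2_def dependent_zero)
next
  case False
  have "v \<in> span {w} \<longleftrightarrow> det2 v w = 0"
  proof
    assume "v \<in> span {w}"
    then show "det2 v w = 0" by (auto simp: span_singleton det2_def)
  next
    assume d: "det2 v w = 0"
    have "w$1 \<noteq> 0 \<or> w$2 \<noteq> 0" using False by (auto simp: vec2_eq_iff)
    then have "v = (v$1 / w$1) *\<^sub>R w \<or> v = (v$2 / w$2) *\<^sub>R w"
      using d by (auto simp: vec2_eq_iff det2_def field_simps)
    then show "v \<in> span {w}" by (metis rangeI span_singleton)
  qed
  with False show ?thesis by (simp add: independent_insert)
qed

lemma lattice_basis_iff:
  "lattice_basis \<Lambda> v w \<longleftrightarrow> det2 v w \<noteq> 0 \<and>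
     (\<forall>u. u \<in> \<Lambda> \<longleftrightarrow> (\<exists>m n :: int. u = of_int m *\<^sub>R v + of_int n *\<^sub>R w))"
  unfolding lattice_basis_def conj_assoc[symmetric] independent_pair_iff_det2
  by (auto simp: set_eq_iff)

lemma lattice_basisE:
  assumes "lattice_basis \<Lambda> v w" "u \<in> \<Lambda>"
  obtains m n :: int where "u = of_int m *\<^sub>R v + of_int n *\<^sub>R w"
  using assms unfolding lattice_basis_iff by blast

lemma lattice_basis_mem:
  "lattice_basis \<Lambda> v w \<Longrightarrow> of_int m *\<^sub>R v + of_int n *\<^sub>R w \<in> \<Lambda>"
  unfolding lattice_basis_iff by blast

lemma lattice_basis_memI:
  "lattice_basis \<Lambda> v w \<Longrightarrow> u = of_int m *\<^sub>R v + of_int n *\<^sub>R w \<Longrightarrow> u \<in> \<Lambda>"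
  unfolding lattice_basis_iff by blast

lemma lattice_basis_lattice: "lattice_basis \<Lambda> v w \<Longrightarrow> is_lattice \<Lambda>"
  unfolding is_lattice_def by blast

lemma lattice_basis_vectors:
  assumes "lattice_basis \<Lambda> v w"
  shows "v \<in> \<Lambda>" "w \<in> \<Lambda>"
  using lattice_basis_mem[OF assms, of 1 0] lattice_basis_mem[OF assms, of 0 1] by auto

text \<open>Together with \<open>lattice_basis_uminus\<close> and \<open>lattice_basis_add\<close>,
  this elementary move composes to every change of basis made below.\<close>

lemma lattice_basis_swap:
  assumes "lattice_basis \<Lambda> v w"
  shows "lattice_basis \<Lambda> w v"
proof -
  have "det2 w v = - det2 v w" by (simp add: det2_def)
  moreover have "(\<exists>m n :: int. u = of_int m *\<^sub>R v + of_int n *\<^sub>R w) \<longleftrightarrow>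
      (\<exists>m n :: int. u = of_int m *\<^sub>R w + of_int n *\<^sub>R v)" for u
    by (metis add.commute)
  ultimately show ?thesis using assms unfolding lattice_basis_iff by simp
qed

lemma lattice_basis_uminus:
  assumes "lattice_basis \<Lambda> v w"
  shows "lattice_basis \<Lambda> (- v) w"
proof -
  have "det2 (- v) w = - det2 v w" by (simp add: det2_def)
  moreover have "(\<exists>m n :: int. u = of_int m *\<^sub>R v + of_int n *\<^sub>R w) \<longleftrightarrow>
      (\<exists>m n :: int. u = of_int m *\<^sub>R (- v) + of_int n *\<^sub>R w)" for u
  proof -
    have "of_int m *\<^sub>R v = of_int (- m) *\<^sub>R (- v)" "of_int m *\<^sub>R (- v) = of_int (- m) *\<^sub>R v" for m :: int
      by simp_all
    then show ?thesis by metis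
  qed
  ultimately show ?thesis using assms unfolding lattice_basis_iff by simp
qed

lemma lattice_basis_add:
  assumes "lattice_basis \<Lambda> v w"
  shows "lattice_basis \<Lambda> (v + w) w"
proof -
  have "det2 (v + w) w = det2 v w" by (simp add: det2_def algebra_simps)
  moreover have "(\<exists>m n :: int. u = of_int m *\<^sub>R v + of_int n *\<^sub>R w) \<longleftrightarrow>
      (\<exists>m n :: int. u = of_int m *\<^sub>R (v + w) + of_int n *\<^sub>R w)" for u
  proof
    assume "\<exists>m n :: int. u = of_int m *\<^sub>R v + of_int n *\<^sub>R w"
    then obtain m n :: int where "u = of_int m *\<^sub>R v + of_int n *\<^sub>R w" by blast
    then have "u = of_int m *\<^sub>R (v + w) + of_int (n - m) *\<^sub>R w" by (simp add: algebra_simps)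
    then show "\<exists>m n :: int. u = of_int m *\<^sub>R (v + w) + of_int n *\<^sub>R w" by blast
  next
    assume "\<exists>m n :: int. u = of_int m *\<^sub>R (v + w) + of_int n *\<^sub>R w"
    then obtain m n :: int where "u = of_int m *\<^sub>R (v + w) + of_int n *\<^sub>R w" by blast
    then have "u = of_int m *\<^sub>R v + of_int (n + m) *\<^sub>R w" by (simp add: algebra_simps)
    then show "\<exists>m n :: int. u = of_int m *\<^sub>R v + of_int n *\<^sub>R w" by blast
  qed
  ultimately show ?thesis using assms unfolding lattice_basis_iff by simp
qed

lemma lattice_diff:
  assumes "is_lattice \<Lambda>" "u \<in> \<Lambda>" "u' \<in> \<Lambda>"
  shows "u - u' \<in> \<Lambda>"
proof -
  obtain v w where b: "lattice_basis \<Lambda> v w" using assms(1) unfolding is_lattice_def by blast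
  obtain m n :: int where "u = of_int m *\<^sub>R v + of_int n *\<^sub>R w" using b assms(2) by (rule lattice_basisE)
  moreover obtain k l :: int where "u' = of_int k *\<^sub>R v + of_int l *\<^sub>R w" using b assms(3) by (rule lattice_basisE)
  ultimately have "u - u' = of_int (m - k) *\<^sub>R v + of_int (n - l) *\<^sub>R w" by (simp add: algebra_simps)
  with b show ?thesis by (rule lattice_basis_memI)
qed

lemma lattice_uminus:
  assumes "is_lattice \<Lambda>" "u \<in> \<Lambda>"
  shows "- u \<in> \<Lambda>"
  using lattice_diff[OF assms(1) assms(2) assms(2)] lattice_diff[OF assms(1), of 0 u] assms by simp

lemma lattice_add:
  assumes "is_lattice \<Lambda>" "u \<in> \<Lambda>" "u' \<in> \<Lambda>"
  shows "u + u' \<in> \<Lambda>"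
  using lattice_diff[OF assms(1,2) lattice_uminus[OF assms(1,3)]] by simp

section \<open>Lattice coordinates as quotients of determinants, and discreteness\<close>

lemma det2_cramer:
  assumes "det2 v w \<noteq> 0"
  shows "u = (det2 u w / det2 v w) *\<^sub>R v + (det2 v u / det2 v w) *\<^sub>R w"
proof -
  have "det2 v w *\<^sub>R u = det2 u w *\<^sub>R v + det2 v u *\<^sub>R w"
    by (simp add: vec2_eq_iff det2_def algebra_simps)
  then have "(1 / det2 v w) *\<^sub>R (det2 v w *\<^sub>R u) = (1 / det2 v w) *\<^sub>R (det2 u w *\<^sub>R v + det2 v u *\<^sub>R w)"
    by simp
  with assms show ?thesis by (simp add: scaleR_add_right)
qed

lemma det2_combination:
  "det2 (a *\<^sub>R v + b *\<^sub>R w) w = a * det2 v w" "det2 v (a *\<^sub>R v + b *\<^sub>R w) = b * det2 v w"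
  by (simp_all add: det2_def algebra_simps)

text \<open>By Cramer's rule the two quotients are the coordinates of \<open>u\<close>. They depend
  continuously on \<open>u\<close>, \<open>v\<close>, \<open>w\<close>, so this form of membership
  can be passed to a limit; their diagonal values also give the trace of a lattice map.\<close>

lemma lattice_mem_iff_det2:
  assumes "lattice_basis \<Lambda> v w"
  shows "u \<in> \<Lambda> \<longleftrightarrow> det2 u w / det2 v w \<in> \<int> \<and> det2 v u / det2 v w \<in> \<int>"
proof
  have d: "det2 v w \<noteq> 0" using assms by (simp add: lattice_basis_iff)
  assume "u \<in> \<Lambda>"
  with assms obtain m n :: int where "u = of_int m *\<^sub>R v + of_int n *\<^sub>R w" by (rule lattice_basisE)
  with d show "det2 u w / det2 v w \<in> \<int> \<and> det2 v u / det2 v w \<in> \<int>"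
    by (simp add: det2_combination)
next
  have d: "det2 v w \<noteq> 0" using assms by (simp add: lattice_basis_iff)
  assume "det2 u w / det2 v w \<in> \<int> \<and> det2 v u / det2 v w \<in> \<int>"
  then obtain m n where "det2 u w / det2 v w = of_int m" "det2 v u / det2 v w = of_int n"
    by (auto elim!: Ints_cases)
  with det2_cramer[OF d, of u] have "u = of_int m *\<^sub>R v + of_int n *\<^sub>R w" by simp
  with assms show "u \<in> \<Lambda>" by (rule lattice_basis_memI)
qed

text \<open>Cauchy-Schwarz for \<open>v\<close> and the vector \<open>w\<close> turned by a right
  angle.\<close>

lemma abs_det2_le: "\<bar>det2 v w\<bar> \<le> norm v * norm w"
proof -
  have "det2 v w = v \<bullet> vector [w$2, - (w$1)]" by (simp add: det2_def inner_vec2)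
  moreover have "norm (vector [w$2, - (w$1)] :: real^2) = norm w"
    by (simp add: norm_eq_sqrt_inner inner_vec2 algebra_simps)
  ultimately show ?thesis by (metis Cauchy_Schwarz_ineq2)
qed

text \<open>Cramer's rule bounds both integer coordinates of a short vector. The finiteness provides
  the minimum in \<open>exists_obtuse_superbase\<close>.\<close>

lemma finite_lattice_ball:
  assumes "is_lattice \<Lambda>"
  shows "finite {u \<in> \<Lambda>. norm u \<le> r}"
proof -
  obtain v w where b: "lattice_basis \<Lambda> v w" using assms unfolding is_lattice_def by blast
  have d: "det2 v w \<noteq> 0" using b by (simp add: lattice_basis_iff)
  define K where "K = (\<lambda>c::real. {m::int. \<bar>of_int m\<bar> \<le> c})"
  have K: "finite (K c)" for c :: real
  proof -
    have "K c \<subseteq> {- \<lceil>c\<rceil>..\<lceil>c\<rceil>}" unfolding K_def by (auto simp: abs_le_iff le_ceiling_iff minus_le_iff) (linarith+)?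
    then show ?thesis by (rule finite_subset) simp
  qed
  \<comment> \<open>The sum of the two norms serves as a common bound for both coordinates.\<close>
  let ?R = "r * (norm v + norm w) / \<bar>det2 v w\<bar>"
  have "{u \<in> \<Lambda>. norm u \<le> r} \<subseteq> (\<lambda>(m, n). of_int m *\<^sub>R v + of_int n *\<^sub>R w) ` (K ?R \<times> K ?R)"
  proof
    fix u assume "u \<in> {u \<in> \<Lambda>. norm u \<le> r}"
    then have u: "u \<in> \<Lambda>" "norm u \<le> r" by auto
    obtain m n :: int where mn: "u = of_int m *\<^sub>R v + of_int n *\<^sub>R w" using b u(1) by (rule lattice_basisE)
    have r: "0 \<le> r" using u(2) norm_ge_zero order_trans by blast
    have "\<bar>of_int m\<bar> * \<bar>det2 v w\<bar> = \<bar>det2 u w\<bar>" "\<bar>of_int n\<bar> * \<bar>det2 v w\<bar> = \<bar>det2 v u\<bar>"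
      by (simp_all add: mn det2_combination abs_mult)
    moreover have "\<bar>det2 u w\<bar> \<le> r * (norm v + norm w)"
      by (rule order_trans[OF abs_det2_le mult_mono]) (use u r in auto)
    moreover have "\<bar>det2 v u\<bar> \<le> (norm v + norm w) * r"
      by (rule order_trans[OF abs_det2_le mult_mono]) (use u r in auto)
    ultimately have "m \<in> K ?R" "n \<in> K ?R" using d unfolding K_def
      by (simp_all add: field_simps)
    then show "u \<in> (\<lambda>(m, n). of_int m *\<^sub>R v + of_int n *\<^sub>R w) ` (K ?R \<times> K ?R)"
      using mn by auto
  qed
  then show ?thesis using K by (meson finite_SigmaI finite_imageI finite_subset)
qed

section \<open>Obtuse superbases: relabelling and existence\<close>

lemma norm_sq_superbase:
  fixes v1 v2 :: "real^2"
  assumes "v0 = - v1 - v2"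
  shows "norm v1 ^ 2 = - (v1 \<bullet> v2) + - (v0 \<bullet> v1)"
    "norm v2 ^ 2 = - (v1 \<bullet> v2) + - (v0 \<bullet> v2)"
    "norm v0 ^ 2 = - (v0 \<bullet> v1) + - (v0 \<bullet> v2)"
  unfolding assms power2_norm_eq_inner by (simp_all add: inner_vec2 algebra_simps)

lemma obtuse_superbase_iff:
  "obtuse_superbase \<Lambda> v0 v1 v2 \<longleftrightarrow> lattice_basis \<Lambda> v1 v2 \<and> v0 + v1 + v2 = 0 \<and>
     v1 \<bullet> v2 \<le> 0 \<and> v0 \<bullet> v1 \<le> 0 \<and> v0 \<bullet> v2 \<le> 0"
proof -
  have "v0 = - v1 - v2 \<longleftrightarrow> v0 + v1 + v2 = 0"
    by (simp add: eq_diff_eq eq_neg_iff_add_eq_0 add_ac)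
  then show ?thesis
    unfolding obtuse_superbase_def superbase_def neg_0_le_iff_le by blast
qed

lemma obtuse_superbase_swap:
  assumes "obtuse_superbase \<Lambda> v0 v1 v2"
  shows "obtuse_superbase \<Lambda> v0 v2 v1"
proof -
  have "lattice_basis \<Lambda> v2 v1"
    using assms lattice_basis_swap unfolding obtuse_superbase_iff by blast
  moreover have "v0 + v2 + v1 = v0 + v1 + v2" by (simp add: add_ac)
  ultimately show ?thesis
    using assms inner_commute[of v1 v2] unfolding obtuse_superbase_iff by simp
qed

text \<open>With \<open>obtuse_superbase_swap\<close> it yields all six orderings, so a fact about
  one vector or one pair of a superbase transfers to the others.\<close>

lemma obtuse_superbase_rotate:
  assumes "obtuse_superbase \<Lambda> v0 v1 v2"
  shows "obtuse_superbase \<Lambda> v1 v2 v0"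
proof -
  have b: "lattice_basis \<Lambda> v1 v2" and v0: "v0 = - (v1 + v2)"
    using assms unfolding obtuse_superbase_def superbase_def by simp_all
  have "lattice_basis \<Lambda> v2 v0" unfolding v0
    by (rule lattice_basis_swap[OF lattice_basis_uminus[OF lattice_basis_add[OF b]]])
  moreover have "v1 + v2 + v0 = v0 + v1 + v2" by (simp add: add_ac)
  ultimately show ?thesis
    using assms inner_commute[of v0 v1] inner_commute[of v0 v2]
    unfolding obtuse_superbase_iff by simp
qed

text \<open>A superbase minimising the sum of squared lengths is obtuse: if \<open>v1 \<bullet> v2 > 0\<close>, then
  \<open>{- v1, v2, v1 - v2}\<close> has a smaller sum.\<close>

lemma exists_obtuse_superbase:
  assumes "is_lattice \<Lambda>"
  shows "\<exists>v0 v1 v2. obtuse_superbase \<Lambda> v0 v1 v2"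
proof -
  define F :: "(real^2) \<times> (real^2) \<Rightarrow> real"
    where "F = (\<lambda>(v, w). norm v ^ 2 + norm w ^ 2 + norm (- v - w) ^ 2)"
  obtain a b where ab: "lattice_basis \<Lambda> a b" using assms unfolding is_lattice_def by blast
  \<comment> \<open>Bases outside \<open>X\<close> have a larger sum than \<open>(a, b)\<close>, so
    a minimum over the finite set \<open>X\<close> is a minimum over all bases.\<close>
  define X where "X = {(v, w). lattice_basis \<Lambda> v w \<and> F (v, w) \<le> F (a, b)}"
  define B where "B = {u \<in> \<Lambda>. norm u \<le> sqrt (F (a, b))}"
  have B: "v \<in> B" if "v \<in> \<Lambda>" "norm v ^ 2 \<le> F (a, b)" for v
    using that unfolding B_def by (simp add: real_le_rsqrt)
  have "X \<subseteq> B \<times> B"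
  proof
    fix z assume "z \<in> X"
    then obtain v w where z: "z = (v, w)" "lattice_basis \<Lambda> v w"
      "norm v ^ 2 + norm w ^ 2 + norm (- v - w) ^ 2 \<le> F (a, b)"
      unfolding X_def by (auto simp: F_def)
    moreover have "0 \<le> norm v ^ 2" "0 \<le> norm w ^ 2" "0 \<le> norm (- v - w) ^ 2" by simp_all
    ultimately have "norm v ^ 2 \<le> F (a, b)" "norm w ^ 2 \<le> F (a, b)" by linarith+
    with z show "z \<in> B \<times> B" using B lattice_basis_vectors by blast
  qed
  then have "finite X" using finite_lattice_ball[OF assms] unfolding B_def
    by (meson finite_SigmaI finite_subset)
  moreover have "(a, b) \<in> X" using ab by (simp add: X_def)
  ultimately have fin: "finite X" "X \<noteq> {}" by auto
  obtain v w where arg: "arg_min_on F X = (v, w)" by fastforce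
  have vw: "(v, w) \<in> X" using arg_min_if_finite(1)[OF fin, of F] arg by simp
  have min: "F (v, w) \<le> F z" if "z \<in> X" for z
    using arg_min_least[OF fin that, of F] arg by simp
  have basis: "lattice_basis \<Lambda> v w" using vw by (simp add: X_def)
  have minimal: "F (v, w) \<le> F (v', w')" if "lattice_basis \<Lambda> v' w'" for v' w'
  proof (cases "(v', w') \<in> X")
    case True
    then show ?thesis by (rule min)
  next
    case False
    with that vw show ?thesis by (auto simp: X_def)
  qed
  have F_eq: "F (v', w') = 2 * (v' \<bullet> v') + 2 * (w' \<bullet> w') + 2 * (v' \<bullet> w')" for v' w'
    unfolding F_def by (simp add: power2_norm_eq_inner inner_vec2 algebra_simps)
  have 1: "lattice_basis \<Lambda> (- v) w" using basis by (rule lattice_basis_uminus)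
  \<comment> \<open>Passing from \<open>(v, w)\<close> to \<open>(v + w, w)\<close> raises
    \<open>F\<close> by \<open>4 * ((v + w) \<bullet> w)\<close>, so minimality gives the sign of
    the product with \<open>- v - w\<close>.\<close>
  have "lattice_basis \<Lambda> (v + w) w" using basis by (rule lattice_basis_add)
  then have 2: "F (v, w) \<le> F (v + w, w)" by (rule minimal)
  have "lattice_basis \<Lambda> (w + v) v" by (rule lattice_basis_add[OF lattice_basis_swap[OF basis]])
  then have 3: "F (v, w) \<le> F (w + v, v)" by (rule minimal)
  have "v \<bullet> w \<le> 0" using minimal[OF 1] by (simp add: F_eq)
  moreover have "(- v - w) \<bullet> v \<le> 0" "(- v - w) \<bullet> w \<le> 0"
    using 2 3 by (simp_all add: F_eq inner_vec2 algebra_simps)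
  ultimately have "obtuse_superbase \<Lambda> (- v - w) v w"
    using basis by (simp add: obtuse_superbase_def superbase_def)
  then show ?thesis by blast
qed

section \<open>Classes modulo 2 and the root invariant\<close>

definition cong2 :: "(real^2) set \<Rightarrow> real^2 \<Rightarrow> real^2 \<Rightarrow> bool" where
  "cong2 \<Lambda> u u' \<longleftrightarrow> (\<exists>l\<in>\<Lambda>. u = u' + 2 *\<^sub>R l)"

lemma cong2_sym: "is_lattice \<Lambda> \<Longrightarrow> cong2 \<Lambda> u u' \<Longrightarrow> cong2 \<Lambda> u' u"
  unfolding cong2_def by (force dest: lattice_uminus)

lemma cong2_trans:
  assumes "is_lattice \<Lambda>" "cong2 \<Lambda> u u'" "cong2 \<Lambda> u' u''"
  shows "cong2 \<Lambda> u u''"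
proof -
  obtain l l' where "l \<in> \<Lambda>" "u = u' + 2 *\<^sub>R l" "l' \<in> \<Lambda>" "u' = u'' + 2 *\<^sub>R l'"
    using assms(2,3) unfolding cong2_def by blast
  then have "u = u'' + 2 *\<^sub>R (l' + l)" "l' + l \<in> \<Lambda>"
    using assms(1) by (simp_all add: scaleR_add_right lattice_add)
  then show ?thesis unfolding cong2_def by blast
qed

lemma cong2_add:
  assumes "is_lattice \<Lambda>" "cong2 \<Lambda> u u'" "cong2 \<Lambda> w w'"
  shows "cong2 \<Lambda> (u + w) (u' + w')"
proof -
  obtain l l' where "l \<in> \<Lambda>" "u = u' + 2 *\<^sub>R l" "l' \<in> \<Lambda>" "w = w' + 2 *\<^sub>R l'"
    using assms(2,3) unfolding cong2_def by blast
  then have "u + w = u' + w' + 2 *\<^sub>R (l + l')" "l + l' \<in> \<Lambda>"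
    using assms(1) by (simp_all add: scaleR_add_right lattice_add)
  then show ?thesis unfolding cong2_def by blast
qed

lemma cong2_refl: "is_lattice \<Lambda> \<Longrightarrow> cong2 \<Lambda> u u"
  unfolding cong2_def is_lattice_def
  using lattice_basis_mem[where m=0 and n=0] by fastforce

lemma cong2_double: "u \<in> \<Lambda> \<Longrightarrow> cong2 \<Lambda> (u + u) 0"
  unfolding cong2_def by (auto simp: scaleR_2)

lemma cong2_uminus:
  assumes "is_lattice \<Lambda>" "u \<in> \<Lambda>"
  shows "cong2 \<Lambda> (- u) u"
proof -
  have "- u = u + 2 *\<^sub>R (- u)" by (simp add: scaleR_2)
  then show ?thesis unfolding cong2_def using lattice_uminus[OF assms] by blast
qed

lemma obtuse_superbase_lattice: "obtuse_superbase \<Lambda> v0 v1 v2 \<Longrightarrow> is_lattice \<Lambda>"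
  unfolding obtuse_superbase_iff by (blast dest: lattice_basis_lattice)

lemma obtuse_superbase_mem:
  assumes "obtuse_superbase \<Lambda> v0 v1 v2"
  shows "v0 \<in> \<Lambda>" "v1 \<in> \<Lambda>" "v2 \<in> \<Lambda>"
  using assms obtuse_superbase_rotate[OF assms] unfolding obtuse_superbase_iff
  by (blast dest: lattice_basis_vectors)+

text \<open>The parities of the two coordinates decide the class; both odd is the class of
  \<open>v0 = - v1 - v2\<close>.\<close>

lemma lattice_cong2_cases:
  assumes "obtuse_superbase \<Lambda> v0 v1 v2" "u \<in> \<Lambda>"
  shows "cong2 \<Lambda> u 0 \<or> cong2 \<Lambda> u v0 \<or> cong2 \<Lambda> u v1 \<or> cong2 \<Lambda> u v2"
proof -
  have b: "lattice_basis \<Lambda> v1 v2" and v0: "v0 = - v1 - v2"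
    using assms(1) by (auto simp: obtuse_superbase_def superbase_def)
  obtain m n :: int where u: "u = of_int m *\<^sub>R v1 + of_int n *\<^sub>R v2"
    using b assms(2) by (rule lattice_basisE)
  let ?w = "\<lambda>k l :: int. of_int k *\<^sub>R v1 + of_int l *\<^sub>R v2"
  have w: "?w k l \<in> \<Lambda>" for k l by (rule lattice_basis_mem[OF b])
  obtain k l where "m = 2 * k \<or> m = 2 * k + 1" "n = 2 * l \<or> n = 2 * l + 1"
    by (metis evenE oddE)
  \<comment> \<open>The shift by \<open>(1, 1)\<close> absorbs the negative coordinates of
    \<open>v0\<close>: \<open>- 1 + 2 * (k + 1) = 2 * k + 1\<close>.\<close>
  then consider "u = 0 + 2 *\<^sub>R ?w k l" | "u = v0 + 2 *\<^sub>R ?w (k + 1) (l + 1)"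
    | "u = v1 + 2 *\<^sub>R ?w k l" | "u = v2 + 2 *\<^sub>R ?w k l"
    by (elim disjE) (simp_all add: u v0 algebra_simps scaleR_2)
  then show ?thesis unfolding cong2_def using w by cases blast+
qed

lemma one_le_odd_square: "(1::real) \<le> (of_int (1 + 2 * m)) ^ 2"
proof -
  have "1 \<le> \<bar>1 + 2 * m\<bar>" by arith
  then have "1 \<le> \<bar>real_of_int (1 + 2 * m)\<bar>" by linarith
  then show ?thesis by (metis one_le_power power2_abs)
qed

text \<open>Selling's formula for the quadratic form of a lattice.\<close>

lemma norm_sq_combination:
  fixes v1 v2 :: "real^2"
  assumes "v0 = - v1 - v2"
  shows "norm (a *\<^sub>R v1 + b *\<^sub>R v2) ^ 2 =
    - (v1 \<bullet> v2) * (a - b) ^ 2 + - (v0 \<bullet> v1) * a ^ 2 + - (v0 \<bullet> v2) * b ^ 2"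
  unfolding power2_norm_eq_inner assms
  by (simp add: inner_vec2 algebra_simps power2_eq_square)

text \<open>In the class of \<open>v1\<close> the first coordinate is odd, the second even, and
  their difference odd. Odd squares are at least 1, so Selling's formula is bounded below by its
  value at \<open>v1\<close>. The second claim is the equality case; it makes an isometry that fixes
  a class act on its shortest vector by a sign.\<close>

lemma cong2_superbase_vector:
  assumes "obtuse_superbase \<Lambda> v0 v1 v2" "cong2 \<Lambda> u v1"
  shows "norm v1 ^ 2 \<le> norm u ^ 2"
    and "norm u = norm v1 \<Longrightarrow> v1 \<bullet> v2 \<noteq> 0 \<Longrightarrow> v0 \<bullet> v1 \<noteq> 0 \<Longrightarrow> v0 \<bullet> v2 \<noteq> 0 \<Longrightarrow>
      u = v1 \<or> u = - v1"
proof -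
  have b: "lattice_basis \<Lambda> v1 v2" and v0: "v0 = - v1 - v2"
    and p: "- (v1 \<bullet> v2) \<ge> 0" "- (v0 \<bullet> v1) \<ge> 0" "- (v0 \<bullet> v2) \<ge> 0"
    using assms(1) by (auto simp: obtuse_superbase_def superbase_def)
  obtain l where l: "l \<in> \<Lambda>" "u = v1 + 2 *\<^sub>R l" using assms(2) unfolding cong2_def by blast
  obtain m n :: int where "l = of_int m *\<^sub>R v1 + of_int n *\<^sub>R v2"
    using b l(1) by (rule lattice_basisE)
  then have u: "u = of_int (1 + 2 * m) *\<^sub>R v1 + of_int (2 * n) *\<^sub>R v2"
    by (simp add: l(2) algebra_simps)
  let ?x = "of_int (1 + 2 * m) :: real" and ?y = "of_int (2 * n) :: real"
  have xy: "?x - ?y = of_int (1 + 2 * (m - n))" by simp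
  have N: "norm u ^ 2 = - (v1 \<bullet> v2) * (?x - ?y) ^ 2 + - (v0 \<bullet> v1) * ?x ^ 2 + - (v0 \<bullet> v2) * ?y ^ 2"
    unfolding u by (rule norm_sq_combination[OF v0])
  have 1: "- (v1 \<bullet> v2) * 1 \<le> - (v1 \<bullet> v2) * (?x - ?y) ^ 2"
    unfolding xy using p(1) one_le_odd_square by (rule mult_left_mono[rotated])
  have 2: "- (v0 \<bullet> v1) * 1 \<le> - (v0 \<bullet> v1) * ?x ^ 2"
    using p(2) one_le_odd_square by (rule mult_left_mono[rotated])
  have 3: "0 \<le> - (v0 \<bullet> v2) * ?y ^ 2" using p(3) by (intro mult_nonneg_nonneg) auto
  have N1: "norm v1 ^ 2 = - (v1 \<bullet> v2) * 1 + - (v0 \<bullet> v1) * 1"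
    using norm_sq_superbase(1)[OF v0] by simp
  show "norm v1 ^ 2 \<le> norm u ^ 2" using 1 2 3 N N1 by linarith
  assume eq: "norm u = norm v1" and nz: "v1 \<bullet> v2 \<noteq> 0" "v0 \<bullet> v1 \<noteq> 0" "v0 \<bullet> v2 \<noteq> 0"
  have "norm u ^ 2 = norm v1 ^ 2" using eq by simp
  \<comment> \<open>The lower bound holds term by term, so equality of the sums forces equality in
    each term.\<close>
  then have "- (v0 \<bullet> v2) * ?y ^ 2 = 0" "- (v0 \<bullet> v1) * ?x ^ 2 = - (v0 \<bullet> v1) * 1"
    using 1 2 3 N N1 by linarith+
  with nz have "?y = 0" "?x ^ 2 = 1" by auto
  then have "?y = 0" "?x = 1 \<or> ?x = - 1" by (auto simp only: power2_eq_1_iff)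
  then show "u = v1 \<or> u = - v1" unfolding u by (elim disjE) (simp_all only:, simp_all)
qed

lemma cong2_norm_le:
  assumes "obtuse_superbase \<Lambda> v0 v1 v2" "v \<in> {v0, v1, v2}" "cong2 \<Lambda> u v"
  shows "norm v \<le> norm u"
proof -
  have "norm v ^ 2 \<le> norm u ^ 2"
    using assms cong2_superbase_vector(1) obtuse_superbase_rotate by blast
  then show ?thesis by (simp add: abs_le_square_iff[symmetric])
qed

text \<open>A basis vector is not twice a lattice vector, since its coordinate 1 is odd.\<close>

lemma superbase_not_cong2_0:
  assumes "obtuse_superbase \<Lambda> v0 v1 v2" "v \<in> {v0, v1, v2}"
  shows "\<not> cong2 \<Lambda> v 0"
proof -
  have "\<not> cong2 \<Lambda> w1 0" if "obtuse_superbase \<Lambda> w0 w1 w2" for w0 w1 w2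
  proof
    assume "cong2 \<Lambda> w1 0"
    then obtain l where l: "l \<in> \<Lambda>" "w1 = 2 *\<^sub>R l" unfolding cong2_def by auto
    have b: "lattice_basis \<Lambda> w1 w2" using that by (simp add: obtuse_superbase_iff)
    then have d: "det2 w1 w2 \<noteq> 0" by (simp add: lattice_basis_iff)
    obtain m n :: int where mn: "l = of_int m *\<^sub>R w1 + of_int n *\<^sub>R w2"
      using b l(1) by (rule lattice_basisE)
    have "det2 w1 w2 = 2 * det2 l w2" using l(2) by (simp add: det2_def algebra_simps)
    also have "\<dots> = of_int (2 * m) * det2 w1 w2" unfolding mn det2_combination by simp
    finally have "(1::real) = of_int (2 * m)" using d by simp
    then have "1 = 2 * m" by linarith
    then show False by presburger
  qed
  then show ?thesis using assms obtuse_superbase_rotate by blast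
qed

text \<open>If two of the vectors were congruent, the third, being minus their sum, would lie in the
  zero class.\<close>

lemma superbase_not_cong2:
  assumes "obtuse_superbase \<Lambda> v0 v1 v2"
  shows "\<not> cong2 \<Lambda> v1 v2" "\<not> cong2 \<Lambda> v0 v1" "\<not> cong2 \<Lambda> v0 v2"
proof -
  have "\<not> cong2 \<Lambda> w1 w2" if w: "obtuse_superbase \<Lambda> w0 w1 w2" for w0 w1 w2
  proof
    assume "cong2 \<Lambda> w1 w2"
    then obtain l where l: "l \<in> \<Lambda>" "w1 = w2 + 2 *\<^sub>R l" unfolding cong2_def by blast
    have "w0 = - w1 - w2" using w by (simp add: obtuse_superbase_def superbase_def)
    then have "w0 = 0 + 2 *\<^sub>R (- w2 - l)" using l(2) by (simp add: scaleR_2)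
    moreover have "- w2 - l \<in> \<Lambda>"
      using w l(1) by (simp add: lattice_diff lattice_uminus obtuse_superbase_lattice obtuse_superbase_mem)
    ultimately have "cong2 \<Lambda> w0 0" unfolding cong2_def by blast
    then show False using superbase_not_cong2_0[OF w] by blast
  qed
  then show "\<not> cong2 \<Lambda> v1 v2" "\<not> cong2 \<Lambda> v0 v1" "\<not> cong2 \<Lambda> v0 v2"
    using assms obtuse_superbase_rotate obtuse_superbase_swap by blast+
qed

text \<open>The lengths of an obtuse superbase are the minimal lengths in the three non-zero classes
  of \<open>\<Lambda>\<close> modulo \<open>2\<Lambda>\<close>, hence do not depend on the superbase.\<close>

lemma obtuse_superbases_norms:
  assumes v: "obtuse_superbase \<Lambda> v0 v1 v2" and w: "obtuse_superbase \<Lambda> w0 w1 w2"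
  shows "(norm w0, norm w1, norm w2) \<in>
    {(norm v0, norm v1, norm v2), (norm v0, norm v2, norm v1), (norm v1, norm v0, norm v2),
     (norm v1, norm v2, norm v0), (norm v2, norm v0, norm v1), (norm v2, norm v1, norm v0)}"
proof -
  note L = obtuse_superbase_lattice[OF v]
  \<comment> \<open>A vector \<open>w\<close> and the vector of the other superbase in its class are
    both shortest there, hence equally long.\<close>
  have match: "\<exists>v \<in> {v0, v1, v2}. cong2 \<Lambda> w v \<and> norm w = norm v" if mem: "w \<in> {w0, w1, w2}" for w
  proof -
    have "w \<in> \<Lambda>" using mem obtuse_superbase_mem[OF w] by blast
    then obtain v' where "v' \<in> {v0, v1, v2}" "cong2 \<Lambda> w v'"
      using lattice_cong2_cases[OF v] superbase_not_cong2_0[OF w mem] by blast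
    moreover from this have "norm w = norm v'"
      using cong2_norm_le[OF v] cong2_norm_le[OF w mem] cong2_sym[OF L] by (meson order_antisym)
    ultimately show ?thesis by blast
  qed
  \<comment> \<open>Distinct vectors of one superbase lie in distinct classes, so the matching is a
    bijection.\<close>
  have diff: "\<not> (cong2 \<Lambda> w1 u \<and> cong2 \<Lambda> w2 u)" "\<not> (cong2 \<Lambda> w0 u \<and> cong2 \<Lambda> w1 u)"
    "\<not> (cong2 \<Lambda> w0 u \<and> cong2 \<Lambda> w2 u)" for u
    using superbase_not_cong2[OF w] cong2_trans[OF L] cong2_sym[OF L] by blast+
  obtain u0 u1 u2 where u: "u0 \<in> {v0, v1, v2}" "u1 \<in> {v0, v1, v2}" "u2 \<in> {v0, v1, v2}"
    and c: "cong2 \<Lambda> w0 u0" "cong2 \<Lambda> w1 u1" "cong2 \<Lambda> w2 u2"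
    and n: "norm w0 = norm u0" "norm w1 = norm u1" "norm w2 = norm u2"
    using match by (metis insertI1 insertI2)
  have "u0 \<noteq> u1" "u0 \<noteq> u2" "u1 \<noteq> u2" using c diff by blast+
  with u show ?thesis unfolding n by auto
qed

text \<open>The relations in \<open>norm_sq_superbase\<close> can be solved for the products, so a
  permutation of the lengths permutes the root products.\<close>

lemma obtuse_superbases_products:
  assumes v: "obtuse_superbase \<Lambda> v0 v1 v2" and w: "obtuse_superbase \<Lambda> w0 w1 w2"
  shows "mset [sqrt (- (w1 \<bullet> w2)), sqrt (- (w0 \<bullet> w1)), sqrt (- (w0 \<bullet> w2))] =
    mset [sqrt (- (v1 \<bullet> v2)), sqrt (- (v0 \<bullet> v1)), sqrt (- (v0 \<bullet> v2))]"
proof -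
  have p: "- (u1 \<bullet> u2) = (norm u1 ^ 2 + norm u2 ^ 2 - norm u0 ^ 2) / 2"
    "- (u0 \<bullet> u1) = (norm u1 ^ 2 + norm u0 ^ 2 - norm u2 ^ 2) / 2"
    "- (u0 \<bullet> u2) = (norm u2 ^ 2 + norm u0 ^ 2 - norm u1 ^ 2) / 2"
    if "obtuse_superbase \<Lambda> u0 u1 u2" for u0 u1 u2
  proof -
    have "u0 = - u1 - u2" using that by (simp add: obtuse_superbase_def superbase_def)
    note norm_sq = norm_sq_superbase[OF this]
    show "- (u1 \<bullet> u2) = (norm u1 ^ 2 + norm u2 ^ 2 - norm u0 ^ 2) / 2"
    "- (u0 \<bullet> u1) = (norm u1 ^ 2 + norm u0 ^ 2 - norm u2 ^ 2) / 2"
    "- (u0 \<bullet> u2) = (norm u2 ^ 2 + norm u0 ^ 2 - norm u1 ^ 2) / 2"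
      unfolding norm_sq by simp_all
  qed
  show ?thesis unfolding p[OF v] p[OF w]
    using obtuse_superbases_norms[OF v w] by (auto simp: add_mset_commute add_ac)
qed

text \<open>Sorting depends only on the multiset of root products, which is common to all obtuse
  superbases; this makes the definite description in \<open>RI\<close> well defined.\<close>

lemma RI_eq:
  assumes v: "obtuse_superbase \<Lambda> v0 v1 v2"
    and le: "- (v1 \<bullet> v2) \<le> - (v0 \<bullet> v1)" "- (v0 \<bullet> v1) \<le> - (v0 \<bullet> v2)"
  shows "RI \<Lambda> = (sqrt (- (v1 \<bullet> v2)), sqrt (- (v0 \<bullet> v1)), sqrt (- (v0 \<bullet> v2)))"
proof -
  let ?l = "\<lambda>v0 v1 v2 :: real^2. [sqrt (- (v1 \<bullet> v2)), sqrt (- (v0 \<bullet> v1)), sqrt (- (v0 \<bullet> v2))]"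
  have s: "sort (?l w0 w1 w2) = ?l v0 v1 v2" if "obtuse_superbase \<Lambda> w0 w1 w2" for w0 w1 w2
  proof (rule properties_for_sort)
    show "mset (?l v0 v1 v2) = mset (?l w0 w1 w2)"
      using obtuse_superbases_products[OF that v] by simp
    show "sorted (?l v0 v1 v2)" using le by simp
  qed
  show ?thesis unfolding RI_def
  proof (rule the_equality)
    show "case (sqrt (- (v1 \<bullet> v2)), sqrt (- (v0 \<bullet> v1)), sqrt (- (v0 \<bullet> v2))) of (r12, r01, r02) \<Rightarrow>
        \<exists>v0 v1 v2. obtuse_superbase \<Lambda> v0 v1 v2 \<and> [r12, r01, r02] = sort (?l v0 v1 v2)"
      unfolding prod.case using v s[OF v, symmetric] by blast
  next
    fix r assume "case r of (r12, r01, r02) \<Rightarrow>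
        \<exists>v0 v1 v2. obtuse_superbase \<Lambda> v0 v1 v2 \<and> [r12, r01, r02] = sort (?l v0 v1 v2)"
    then obtain r12 r01 r02 w0 w1 w2 where "r = (r12, r01, r02)"
      "obtuse_superbase \<Lambda> w0 w1 w2" "[r12, r01, r02] = sort (?l w0 w1 w2)" by (auto split: prod.splits)
    with s show "r = (sqrt (- (v1 \<bullet> v2)), sqrt (- (v0 \<bullet> v1)), sqrt (- (v0 \<bullet> v2)))" by simp
  qed
qed

text \<open>The six orderings of a superbase permute the three products in all possible
  ways.\<close>

lemma obtuse_superbase_sort:
  assumes "obtuse_superbase \<Lambda> v0 v1 v2"
  obtains w0 w1 w2 where "obtuse_superbase \<Lambda> w0 w1 w2" "{w0, w1, w2} = {v0, v1, v2}"
    "- (w1 \<bullet> w2) \<le> - (w0 \<bullet> w1)" "- (w0 \<bullet> w1) \<le> - (w0 \<bullet> w2)"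
proof -
  note a = assms obtuse_superbase_swap[OF assms]
  note b = a a[THEN obtuse_superbase_rotate]
     a[THEN obtuse_superbase_rotate, THEN obtuse_superbase_rotate]
  have "\<exists>w0 w1 w2. obtuse_superbase \<Lambda> w0 w1 w2 \<and> {w0, w1, w2} = {v0, v1, v2} \<and>
      - (w1 \<bullet> w2) \<le> - (w0 \<bullet> w1) \<and> - (w0 \<bullet> w1) \<le> - (w0 \<bullet> w2)"
  proof -
    have "\<exists>(w0, w1, w2) \<in> {(v0,v1,v2), (v0,v2,v1), (v1,v2,v0), (v2,v1,v0), (v2,v0,v1), (v1,v0,v2)}.
      - (w1 \<bullet> w2) \<le> - (w0 \<bullet> w1) \<and> - (w0 \<bullet> w1) \<le> - (w0 \<bullet> w2)"
      by (simp add: inner_commute[of v1 v0] inner_commute[of v2 v0] inner_commute[of v2 v1]) linarith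
    then show ?thesis using b by auto
  qed
  then show thesis using that by blast
qed

section \<open>Projected invariants of symmetric lattices\<close>

text \<open>The two products at \<open>v1\<close> add up to the squared length of \<open>v1\<close>.
  This is what keeps the vertex \<open>(1, 0)\<close> out of the range of \<open>PI\<close>.\<close>

lemma obtuse_superbase_at_most_one_zero:
  assumes "obtuse_superbase \<Lambda> v0 v1 v2"
  shows "\<not> (v1 \<bullet> v2 = 0 \<and> v0 \<bullet> v1 = 0)"
proof
  assume "v1 \<bullet> v2 = 0 \<and> v0 \<bullet> v1 = 0"
  moreover have v: "v0 = - v1 - v2" "det2 v1 v2 \<noteq> 0"
    using assms by (auto simp: obtuse_superbase_def superbase_def lattice_basis_iff)
  ultimately have "norm v1 ^ 2 = 0" using norm_sq_superbase(1)[OF v(1)] by simp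
  then have "v1 = 0" by simp
  with v(2) show False by (simp add: det2_def)
qed

lemma PI_eq:
  assumes "obtuse_superbase \<Lambda> v0 v1 v2"
    and "- (v1 \<bullet> v2) \<le> - (v0 \<bullet> v1)" "- (v0 \<bullet> v1) \<le> - (v0 \<bullet> v2)"
    and "s = sqrt (- (v1 \<bullet> v2)) + sqrt (- (v0 \<bullet> v1)) + sqrt (- (v0 \<bullet> v2))"
  shows "PI \<Lambda> = ((sqrt (- (v0 \<bullet> v2)) - sqrt (- (v0 \<bullet> v1))) / s, 3 * sqrt (- (v1 \<bullet> v2)) / s)"
  unfolding PI_def RI_eq[OF assms(1-3)] by (simp add: Let_def assms(4) diff_divide_distrib)

text \<open>The normal form from which all values of \<open>PI\<close> are analysed below.
  Positivity of \<open>b\<close> holds because at most one product vanishes and \<open>a\<close> is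
  the smallest.\<close>

lemma PI_obtain:
  assumes "is_lattice \<Lambda>"
  obtains v0 v1 v2 a b c where "obtuse_superbase \<Lambda> v0 v1 v2"
    "- (v1 \<bullet> v2) = a ^ 2" "- (v0 \<bullet> v1) = b ^ 2" "- (v0 \<bullet> v2) = c ^ 2"
    "0 \<le> a" "a \<le> b" "b \<le> c" "0 < b"
    "PI \<Lambda> = ((c - b) / (a + b + c), 3 * a / (a + b + c))"
proof -
  obtain u0 u1 u2 where "obtuse_superbase \<Lambda> u0 u1 u2" using exists_obtuse_superbase[OF assms] by blast
  then obtain v0 v1 v2 where v: "obtuse_superbase \<Lambda> v0 v1 v2"
    and le: "- (v1 \<bullet> v2) \<le> - (v0 \<bullet> v1)" "- (v0 \<bullet> v1) \<le> - (v0 \<bullet> v2)"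
    by (rule obtuse_superbase_sort)
  have nn: "0 \<le> - (v1 \<bullet> v2)" using v by (simp add: obtuse_superbase_def)
  have "- (v0 \<bullet> v1) \<noteq> 0" using obtuse_superbase_at_most_one_zero[OF v] nn le by linarith
  then have pos: "0 < - (v0 \<bullet> v1)" using nn le by linarith
  show thesis
    by (rule that[OF v, of "sqrt (- (v1 \<bullet> v2))" "sqrt (- (v0 \<bullet> v1))" "sqrt (- (v0 \<bullet> v2))"])
      (use PI_eq[OF v le refl] nn le pos in auto)
qed

text \<open>After clearing the denominator, \<open>x + y \<le> 1\<close> is
  \<open>a \<le> b\<close>, \<open>x < 1\<close> is \<open>0 < a + 2 * b\<close>, and
  \<open>y \<le> 1\<close> is \<open>2 * a \<le> b + c\<close>.\<close>

lemma PI_bounds: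
  assumes "is_lattice \<Lambda>" "PI \<Lambda> = (x, y)"
  shows "0 \<le> x" "x < 1" "0 \<le> y" "y \<le> 1" "x + y \<le> 1"
proof -
  from assms(1) obtain v0 v1 v2 a b c where *: "0 \<le> a" "a \<le> b" "b \<le> c" "0 < b"
    and P: "PI \<Lambda> = ((c - b) / (a + b + c), 3 * a / (a + b + c))"
    by (rule PI_obtain)
  have s: "0 < a + b + c" using * by linarith
  have xy: "x = (c - b) / (a + b + c)" "y = 3 * a / (a + b + c)" using P assms(2) by auto
  have "x + y = (c - b + 3 * a) / (a + b + c)" unfolding xy by (simp add: add_divide_distrib)
  also have "\<dots> \<le> 1" using * s by (simp add: divide_le_eq)
  finally show "x + y \<le> 1" .
  show "0 \<le> x" "x < 1" "0 \<le> y" "y \<le> 1" unfolding xy using * s by (simp_all add: divide_less_eq divide_le_eq)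
qed

text \<open>In contrast to \<open>point_group\<close>, an inclusion is demanded instead of equality
  of the image with \<open>\<Lambda>\<close>, because an inclusion is what the passage to limits
  delivers.\<close>

definition lattice_isometry :: "(real^2) set \<Rightarrow> (real^2 \<Rightarrow> real^2) \<Rightarrow> bool" where
  "lattice_isometry \<Lambda> f \<longleftrightarrow> linear f \<and> (\<forall>u. norm (f u) = norm u) \<and> f ` \<Lambda> \<subseteq> \<Lambda>"

lemma lattice_isometry_cong2:
  assumes "lattice_isometry \<Lambda> f" "cong2 \<Lambda> u u'"
  shows "cong2 \<Lambda> (f u) (f u')"
proof -
  have f: "linear f" "f ` \<Lambda> \<subseteq> \<Lambda>" using assms(1) by (simp_all add: lattice_isometry_def)
  obtain l where "l \<in> \<Lambda>" "u = u' + 2 *\<^sub>R l" using assms(2) unfolding cong2_def by blast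
  then have "f u = f u' + 2 *\<^sub>R f l" "f l \<in> \<Lambda>"
    using f by (auto simp: linear_add linear_scale)
  then show ?thesis unfolding cong2_def by blast
qed

lemma cong2_minus:
  assumes "is_lattice \<Lambda>" "cong2 \<Lambda> u u'" shows "cong2 \<Lambda> (- u) (- u')"
proof -
  obtain l where "l \<in> \<Lambda>" "u = u' + 2 *\<^sub>R l" using assms(2) unfolding cong2_def by blast
  then have "- u = - u' + 2 *\<^sub>R (- l)" "- l \<in> \<Lambda>" using lattice_uminus[OF assms(1)] by simp_all
  then show ?thesis unfolding cong2_def by blast
qed

lemma cong2_diff:
  assumes "is_lattice \<Lambda>" "cong2 \<Lambda> u u'" "cong2 \<Lambda> w w'"
  shows "cong2 \<Lambda> (u - w) (u' - w')"
  using cong2_add[OF assms(1,2) cong2_minus[OF assms(1,3)]] by simp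

lemma superbase_cong2_sum:
  assumes "obtuse_superbase \<Lambda> v0 v1 v2"
  shows "cong2 \<Lambda> (v1 + v2) v0" "cong2 \<Lambda> (v1 - v2) v0"
proof -
  have v0: "v0 = - v1 - v2" using assms by (simp add: obtuse_superbase_def superbase_def)
  have "v1 + v2 = v0 + 2 *\<^sub>R (v1 + v2)" "v1 - v2 = v0 + 2 *\<^sub>R v1" by (simp_all add: v0 scaleR_2)
  then show "cong2 \<Lambda> (v1 + v2) v0" "cong2 \<Lambda> (v1 - v2) v0"
    unfolding cong2_def
    using obtuse_superbase_mem[OF assms] lattice_add[OF obtuse_superbase_lattice[OF assms]] by blast+
qed

text \<open>For a map of order 4 fixing the class of \<open>v0\<close>, the vector \<open>l = (f v0 - v0) / 2\<close> and its
  image \<open>f l = - v0 - l\<close> represent the classes of \<open>v1\<close> and \<open>v2\<close>, so \<open>v1\<close> and \<open>v2\<close> are at most as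
  long as \<open>l\<close>, while \<open>\<bar>v0\<bar>\<^sup>2 = 2 \<bar>l\<bar>\<^sup>2\<close>.\<close>

lemma quarter_turn_fixed_class:
  assumes v: "obtuse_superbase \<Lambda> v0 v1 v2" and f: "lattice_isometry \<Lambda> f"
    and ff: "\<And>u. f (f u) = - u" and fix0: "cong2 \<Lambda> (f v0) v0"
  shows "v1 \<bullet> v2 = 0" "v0 \<bullet> v1 = v0 \<bullet> v2"
proof -
  note L = obtuse_superbase_lattice[OF v]
  note tr = cong2_trans[OF L] and sy = cong2_sym[OF L]
  have lin: "linear f" and nf: "\<And>u. norm (f u) = norm u" and im: "\<And>u. u \<in> \<Lambda> \<Longrightarrow> f u \<in> \<Lambda>"
    using f by (auto simp: lattice_isometry_def)
  have v0: "v0 = - v1 - v2" using v by (simp add: obtuse_superbase_def superbase_def)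
  obtain l where l: "l \<in> \<Lambda>" "f v0 = v0 + 2 *\<^sub>R l" using fix0 unfolding cong2_def by blast
  have "f (f v0) = f v0 + 2 *\<^sub>R f l" using l(2) lin by (simp add: linear_add linear_scale)
  then have "2 *\<^sub>R f l = - v0 - f v0" unfolding ff by (simp add: algebra_simps)
  then have "2 *\<^sub>R f l = 2 *\<^sub>R (- v0 - l)" unfolding l(2) by (simp add: vec2_eq_iff)
  then have fl: "f l = - v0 - l" by simp
  \<comment> \<open>The vectors \<open>v0 + f v0\<close> and \<open>v0 - f v0\<close> are equally
    long, so \<open>f v0\<close> is orthogonal to \<open>v0\<close>.\<close>
  have "norm (f v0 + f (f v0)) = norm (v0 + f v0)"
    using nf[of "v0 + f v0"] lin by (simp add: linear_add)
  then have "norm (f v0 - v0) ^ 2 = norm (v0 + f v0) ^ 2" unfolding ff by simp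
  then have orth: "v0 \<bullet> f v0 = 0"
    unfolding power2_norm_eq_inner by (simp add: inner_diff_left inner_add_left inner_diff_right inner_add_right inner_commute)
  have "norm (2 *\<^sub>R l) ^ 2 = norm (f v0 - v0) ^ 2" using l(2) by simp
  also have "\<dots> = norm (f v0) ^ 2 + norm v0 ^ 2"
    unfolding power2_norm_eq_inner using orth by (simp add: inner_diff_left inner_diff_right inner_commute)
  finally have nl: "2 * norm l ^ 2 = norm v0 ^ 2" unfolding nf by (simp add: power_mult_distrib)
  \<comment> \<open>Since \<open>l + f l = - v0\<close>, having \<open>l\<close> in the zero class
    or in that of \<open>v0\<close> would put \<open>v0\<close> into the zero class.\<close>
  have "\<not> cong2 \<Lambda> l 0"
  proof
    assume a: "cong2 \<Lambda> l 0"
    from cong2_add[OF L a lattice_isometry_cong2[OF f a]] have "cong2 \<Lambda> (- v0) 0"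
      unfolding fl using lin by (simp add: linear_0)
    from cong2_minus[OF L this] show False using superbase_not_cong2_0[OF v] by simp
  qed
  moreover have "\<not> cong2 \<Lambda> l v0"
  proof
    assume a: "cong2 \<Lambda> l v0"
    have "cong2 \<Lambda> (f l) v0" using lattice_isometry_cong2[OF f a] fix0 tr by blast
    from cong2_add[OF L a this] have "cong2 \<Lambda> (- v0) (v0 + v0)" unfolding fl by simp
    from tr[OF this cong2_double] have "cong2 \<Lambda> (- v0) 0" using obtuse_superbase_mem[OF v] by blast
    from cong2_minus[OF L this] show False using superbase_not_cong2_0[OF v] by simp
  qed
  ultimately consider "cong2 \<Lambda> l v1" | "cong2 \<Lambda> l v2" using lattice_cong2_cases[OF v l(1)] by blast
  \<comment> \<open>If \<open>l\<close> represents one of the two classes, then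
    \<open>f l = - v0 - l\<close> represents the other, and it is as long as
    \<open>l\<close>.\<close>
  then have "norm v1 \<le> norm l \<and> norm v2 \<le> norm l"
  proof cases
    case 1
    from cong2_diff[OF L cong2_refl[OF L, of "- v0"] this] have "cong2 \<Lambda> (f l) v2" unfolding fl v0 by simp
    then show ?thesis using 1 cong2_norm_le[OF v _ 1] cong2_norm_le[OF v, of v2 "f l"] nf by simp
  next
    case 2
    from cong2_diff[OF L cong2_refl[OF L, of "- v0"] this] have "cong2 \<Lambda> (f l) v1" unfolding fl v0 by simp
    then show ?thesis using 2 cong2_norm_le[OF v _ 2] cong2_norm_le[OF v, of v1 "f l"] nf by simp
  qed
  then have "norm v1 ^ 2 \<le> norm l ^ 2" "norm v2 ^ 2 \<le> norm l ^ 2" by (simp_all add: power_mono)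
  moreover have "0 \<le> - (v1 \<bullet> v2)" using v by (simp add: obtuse_superbase_def)
  \<comment> \<open>The squares of \<open>norm v1\<close> and \<open>norm v2\<close> sum to that of
    \<open>norm v0\<close> plus \<open>- 2 * (v1 \<bullet> v2)\<close>, yet they sum to at most
    \<open>2 * norm l ^ 2 = norm v0 ^ 2\<close>. So the product vanishes and both bounds are
    equalities.\<close>
  ultimately show "v1 \<bullet> v2 = 0" "v0 \<bullet> v1 = v0 \<bullet> v2" using nl norm_sq_superbase[OF v0] by linarith+
qed

text \<open>As \<open>- u\<close> is congruent to \<open>u\<close>, such a map induces an involution
  on the three non-zero classes, and an involution of three objects fixes one of them.\<close>

lemma quarter_turn_PI:
  assumes L: "is_lattice \<Lambda>" and f: "lattice_isometry \<Lambda> f" and ff: "\<And>u. f (f u) = - u"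
  shows "PI \<Lambda> = (0, 0)"
proof -
  from L obtain v0 v1 v2 a b c where v: "obtuse_superbase \<Lambda> v0 v1 v2"
    and p: "- (v1 \<bullet> v2) = a ^ 2" "- (v0 \<bullet> v1) = b ^ 2" "- (v0 \<bullet> v2) = c ^ 2"
    and *: "0 \<le> a" "a \<le> b" "b \<le> c" "0 < b"
    and P: "PI \<Lambda> = ((c - b) / (a + b + c), 3 * a / (a + b + c))"
    by (rule PI_obtain)
  have lin: "linear f" using f by (simp add: lattice_isometry_def)
  \<comment> \<open>If the classes of \<open>w1\<close> and \<open>w2\<close> are interchanged, the
    class of \<open>w0 = - w1 - w2\<close> is fixed.\<close>
  have swap: "cong2 \<Lambda> (f w0) w0" if w: "obtuse_superbase \<Lambda> w0 w1 w2" and c: "cong2 \<Lambda> (f w1) w2" for w0 w1 w2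
  proof -
    have "cong2 \<Lambda> (f (f w1)) (f w2)" using lattice_isometry_cong2[OF f c] .
    then have "cong2 \<Lambda> (f w2) w1"
      using cong2_sym[OF L] cong2_trans[OF L] cong2_uminus[OF L] obtuse_superbase_mem[OF w] unfolding ff by meson
    from cong2_minus[OF L cong2_add[OF L c this]] have "cong2 \<Lambda> (- f w1 - f w2) (- w1 - w2)"
      by (simp add: algebra_simps)
    moreover have "w0 = - w1 - w2" using w by (simp add: obtuse_superbase_def superbase_def)
    ultimately show ?thesis using lin by (simp add: linear_diff linear_neg)
  qed
  have "\<not> cong2 \<Lambda> (f v1) 0"
  proof
    assume "cong2 \<Lambda> (f v1) 0"
    from lattice_isometry_cong2[OF f this] have "cong2 \<Lambda> (- v1) 0" unfolding ff using lin by (simp add: linear_0)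
    from cong2_minus[OF L this] show False using superbase_not_cong2_0[OF v] by simp
  qed
  moreover have "f v1 \<in> \<Lambda>" using f obtuse_superbase_mem[OF v] by (auto simp: lattice_isometry_def)
  ultimately consider "cong2 \<Lambda> (f v1) v0" | "cong2 \<Lambda> (f v1) v1" | "cong2 \<Lambda> (f v1) v2"
    using lattice_cong2_cases[OF v] by blast
  then consider "cong2 \<Lambda> (f v0) v0" | "cong2 \<Lambda> (f v1) v1" | "cong2 \<Lambda> (f v2) v2"
    using swap[OF v] swap[OF obtuse_superbase_rotate[OF obtuse_superbase_rotate[OF v], THEN obtuse_superbase_swap]]
    by cases blast+
  then have "a ^ 2 = 0 \<and> b ^ 2 = c ^ 2 \<or> c ^ 2 = 0 \<and> b ^ 2 = a ^ 2 \<or> b ^ 2 = 0 \<and> c ^ 2 = a ^ 2"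
  proof cases
    case 1
    from quarter_turn_fixed_class[OF v f ff 1] show ?thesis using p by simp
  next
    case 2
    from quarter_turn_fixed_class[OF obtuse_superbase_rotate[OF v] f ff 2] show ?thesis
      using p by (simp add: inner_commute)
  next
    case 3
    from quarter_turn_fixed_class[OF obtuse_superbase_rotate[OF obtuse_superbase_rotate[OF v]] f ff 3] show ?thesis
      using p by (simp add: inner_commute)
  qed
  \<comment> \<open>Only the first alternative is compatible with
    \<open>0 < b \<le> c\<close>.\<close>
  with * have "a = 0" "b = c" by (auto simp: power2_eq_iff)
  then show ?thesis unfolding P by simp
qed

text \<open>The relation makes \<open>f\<close> run cyclically through the classes of
  \<open>v1\<close>, \<open>v2\<close>, \<open>v0\<close>. Each vector is at most as long as its
  predecessor, so going round the cycle gives equality.\<close>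

lemma sixth_turn_norms:
  assumes v: "obtuse_superbase \<Lambda> v0 v1 v2" and f: "lattice_isometry \<Lambda> f"
    and ff: "\<And>u. f (f u) = f u - u" and c: "cong2 \<Lambda> (f v1) v2"
  shows "norm v1 = norm v2" "norm v0 = norm v2"
proof -
  note L = obtuse_superbase_lattice[OF v]
  have nf: "norm (f u) = norm u" for u using f by (simp add: lattice_isometry_def)
  have step: "cong2 \<Lambda> (f w2) w0" if w: "obtuse_superbase \<Lambda> w0 w1 w2" and c: "cong2 \<Lambda> (f w1) w2" for w0 w1 w2
  proof -
    have "cong2 \<Lambda> (f w2) (f w1 - w1)"
      using cong2_sym[OF L lattice_isometry_cong2[OF f c]] unfolding ff .
    moreover have "cong2 \<Lambda> (f w1 - w1) (w2 - w1)" using cong2_diff[OF L c cong2_refl[OF L]] .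
    ultimately show ?thesis
      using superbase_cong2_sum(2)[OF obtuse_superbase_swap[OF w]] cong2_trans[OF L] by blast
  qed
  have "cong2 \<Lambda> (f v2) v0" using step[OF v c] .
  moreover from step[OF obtuse_superbase_rotate[OF v] this] have "cong2 \<Lambda> (f v0) v1" .
  ultimately have "norm v0 \<le> norm v2" "norm v1 \<le> norm v0" "norm v2 \<le> norm v1"
    using c cong2_norm_le[OF v] nf by (metis insertCI)+
  then show "norm v1 = norm v2" "norm v0 = norm v2" by linarith+
qed

text \<open>On the classes, \<open>f (f u) = f u - u\<close> excludes a fixed class, so
  \<open>f\<close> permutes them cyclically in one of the two directions. Equal lengths then mean
  equal products.\<close>

lemma sixth_turn_PI:
  assumes L: "is_lattice \<Lambda>" and f: "lattice_isometry \<Lambda> f" and ff: "\<And>u. f (f u) = f u - u"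
  shows "PI \<Lambda> = (0, 1)"
proof -
  from L obtain v0 v1 v2 a b c where v: "obtuse_superbase \<Lambda> v0 v1 v2"
    and p: "- (v1 \<bullet> v2) = a ^ 2" "- (v0 \<bullet> v1) = b ^ 2" "- (v0 \<bullet> v2) = c ^ 2"
    and *: "0 \<le> a" "a \<le> b" "b \<le> c" "0 < b"
    and P: "PI \<Lambda> = ((c - b) / (a + b + c), 3 * a / (a + b + c))"
    by (rule PI_obtain)
  have lin: "linear f" using f by (simp add: lattice_isometry_def)
  have v0: "v0 = - v1 - v2" using v by (simp add: obtuse_superbase_def superbase_def)
  have m: "v1 \<in> \<Lambda>" "f v1 \<in> \<Lambda>" using f obtuse_superbase_mem[OF v] by (auto simp: lattice_isometry_def)
  have "\<not> cong2 \<Lambda> (f v1) 0"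
  proof
    assume z: "cong2 \<Lambda> (f v1) 0"
    from lattice_isometry_cong2[OF f this] have "cong2 \<Lambda> (f v1 - v1) 0" unfolding ff using lin by (simp add: linear_0)
    from cong2_diff[OF L z this] show False using superbase_not_cong2_0[OF v] by simp
  qed
  moreover have "\<not> cong2 \<Lambda> (f v1) v1"
  proof
    assume z: "cong2 \<Lambda> (f v1) v1"
    from lattice_isometry_cong2[OF f this] have "cong2 \<Lambda> (f v1 - v1) (f v1)" unfolding ff .
    from cong2_minus[OF L cong2_diff[OF L this cong2_refl[OF L, of "f v1"]]]
    show False using superbase_not_cong2_0[OF v] by simp
  qed
  ultimately consider "cong2 \<Lambda> (f v1) v2" | "cong2 \<Lambda> (f v1) v0"
    using lattice_cong2_cases[OF v m(2)] by blast
  then have "norm v1 = norm v2 \<and> norm v0 = norm v2"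
  proof cases
    case 1
    then show ?thesis using sixth_turn_norms[OF v f ff] by blast
  next
    case 2
    then show ?thesis
      using sixth_turn_norms[OF obtuse_superbase_rotate[OF obtuse_superbase_rotate[OF v], THEN obtuse_superbase_swap] f ff]
      by simp
  qed
  then have "norm v1 ^ 2 = norm v2 ^ 2" "norm v0 ^ 2 = norm v2 ^ 2" by simp_all
  then have "a ^ 2 = b ^ 2" "b ^ 2 = c ^ 2" unfolding norm_sq_superbase[OF v0] p by linarith+
  with * have "b = a" "c = a" by (auto simp: power2_eq_iff)
  then show ?thesis unfolding P using * by simp
qed

text \<open>If the products are distinct and positive, the three lengths differ, every class is
  fixed, and \<open>f\<close> maps \<open>v1\<close> and \<open>v2\<close> to themselves up to sign.
  Equal signs make \<open>f\<close> the identity or its negative, which the witnesses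
  \<open>w\<close> and \<open>w'\<close> exclude; opposite signs make \<open>v1\<close> and
  \<open>v2\<close> orthogonal.\<close>

lemma reflection_PI:
  assumes L: "is_lattice \<Lambda>" and f: "lattice_isometry \<Lambda> f" and ff: "\<And>u. f (f u) = u"
    and nontrivial: "f w \<noteq> w" "f w' \<noteq> - w'" and xy: "PI \<Lambda> = (x, y)"
  shows "x = 0 \<or> y = 0 \<or> x + y = 1"
proof -
  from L obtain v0 v1 v2 a b c where v: "obtuse_superbase \<Lambda> v0 v1 v2"
    and p: "- (v1 \<bullet> v2) = a ^ 2" "- (v0 \<bullet> v1) = b ^ 2" "- (v0 \<bullet> v2) = c ^ 2"
    and *: "0 \<le> a" "a \<le> b" "b \<le> c" "0 < b"
    and P: "PI \<Lambda> = ((c - b) / (a + b + c), 3 * a / (a + b + c))"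
    by (rule PI_obtain)
  have lin: "linear f" and nf: "\<And>u. norm (f u) = norm u" using f by (simp_all add: lattice_isometry_def)
  have v0: "v0 = - v1 - v2" and b: "lattice_basis \<Lambda> v1 v2"
    using v by (simp_all add: obtuse_superbase_def superbase_def)
  \<comment> \<open>For an involution, \<open>u\<close> and the vector \<open>t\<close> in the class
    of \<open>f u\<close> bound each other's length.\<close>
  have cases: "\<exists>t \<in> {v0, v1, v2}. cong2 \<Lambda> (f u) t \<and> norm u = norm t" if u: "u \<in> {v0, v1, v2}" for u
  proof -
    have "\<not> cong2 \<Lambda> (f u) 0"
    proof
      assume "cong2 \<Lambda> (f u) 0"
      from lattice_isometry_cong2[OF f this] have "cong2 \<Lambda> u 0" unfolding ff using lin by (simp add: linear_0)
      then show False using superbase_not_cong2_0[OF v u] by simp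
    qed
    moreover have "f u \<in> \<Lambda>" using u f obtuse_superbase_mem[OF v] by (auto simp: lattice_isometry_def)
    ultimately obtain t where t: "t \<in> {v0, v1, v2}" "cong2 \<Lambda> (f u) t"
      using lattice_cong2_cases[OF v] by blast
    have "cong2 \<Lambda> (f t) u" using cong2_sym[OF L lattice_isometry_cong2[OF f t(2)]] unfolding ff .
    then have "norm u = norm t" using cong2_norm_le[OF v u, of "f t"] cong2_norm_le[OF v t] nf by force
    with t show ?thesis by blast
  qed
  have "a = 0 \<or> a = b \<or> b = c"
  proof (rule ccontr)
    assume neg: "\<not> (a = 0 \<or> a = b \<or> b = c)"
    with * have ne: "a ^ 2 \<noteq> b ^ 2" "b ^ 2 \<noteq> c ^ 2" "a ^ 2 \<noteq> c ^ 2" "a ^ 2 \<noteq> 0" "b ^ 2 \<noteq> 0" "c ^ 2 \<noteq> 0"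
      by (auto simp: power2_eq_iff)
    have "norm v1 ^ 2 \<noteq> norm v2 ^ 2" "norm v0 ^ 2 \<noteq> norm v1 ^ 2" "norm v0 ^ 2 \<noteq> norm v2 ^ 2"
      unfolding norm_sq_superbase[OF v0] p using ne by simp_all
    then have "norm v1 \<noteq> norm v2" "norm v0 \<noteq> norm v1" "norm v0 \<noteq> norm v2" by auto
    then have "cong2 \<Lambda> (f v1) v1" "cong2 \<Lambda> (f v2) v2" using cases[of v1] cases[of v2] by auto
    then have f12: "f v1 = v1 \<or> f v1 = - v1" "f v2 = v2 \<or> f v2 = - v2"
      using cong2_superbase_vector(2)[OF v] cong2_superbase_vector(2)[OF obtuse_superbase_swap[OF v]] nf ne p
      by (auto simp: inner_commute)
    have fu: "f u = (det2 u v2 / det2 v1 v2) *\<^sub>R f v1 + (det2 v1 u / det2 v1 v2) *\<^sub>R f v2"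
      "u = (det2 u v2 / det2 v1 v2) *\<^sub>R v1 + (det2 v1 u / det2 v1 v2) *\<^sub>R v2" for u
    proof -
      have d: "det2 v1 v2 \<noteq> 0" using b by (simp add: lattice_basis_iff)
      show u: "u = (det2 u v2 / det2 v1 v2) *\<^sub>R v1 + (det2 v1 u / det2 v1 v2) *\<^sub>R v2" by (rule det2_cramer[OF d])
      show "f u = (det2 u v2 / det2 v1 v2) *\<^sub>R f v1 + (det2 v1 u / det2 v1 v2) *\<^sub>R f v2"
        by (subst u) (simp only: linear_add[OF lin] linear_scale[OF lin])
    qed
    have "\<not> (f v1 = v1 \<and> f v2 = v2)" using nontrivial(1) fu[of w] by metis
    moreover have "\<not> (f v1 = - v1 \<and> f v2 = - v2)"
    proof
      assume "f v1 = - v1 \<and> f v2 = - v2"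
      then have "f w' = - ((det2 w' v2 / det2 v1 v2) *\<^sub>R v1 + (det2 v1 w' / det2 v1 v2) *\<^sub>R v2)"
        unfolding fu(1)[of w'] by simp
      also have "\<dots> = - w'" using fu(2)[of w'] by simp
      finally show False using nontrivial(2) by simp
    qed
    \<comment> \<open>With opposite signs the two diagonals of the parallelogram are exchanged, so
      it is a rectangle.\<close>
    ultimately have "f (v1 + v2) = v1 - v2 \<or> f (v1 + v2) = - (v1 - v2)"
      using f12 by (auto simp: linear_add[OF lin])
    then have "norm (v1 + v2) ^ 2 = norm (v1 - v2) ^ 2" using nf by (metis norm_minus_cancel)
    then have "v1 \<bullet> v2 = 0" unfolding power2_norm_eq_inner by (simp add: inner_vec2 algebra_simps)
    then show False using ne p by simp
  qed
  moreover have "x = (c - b) / (a + b + c)" "y = 3 * a / (a + b + c)" using P xy by simp_all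
  ultimately show ?thesis using * by (auto simp: add_divide_distrib[symmetric])
qed

section \<open>Point groups\<close>

text \<open>The matrix with rows \<open>(a, b)\<close> and \<open>(c, d)\<close>: rotations and
  reflections become one family, so a single limit argument covers both.\<close>

definition lin2 :: "real \<Rightarrow> real \<Rightarrow> real \<Rightarrow> real \<Rightarrow> real^2 \<Rightarrow> real^2" where
  "lin2 a b c d u = vector [a * u$1 + b * u$2, c * u$1 + d * u$2]"

lemma lin2_nth [simp]:
  "lin2 a b c d u $ 1 = a * u$1 + b * u$2" "lin2 a b c d u $ 2 = c * u$1 + d * u$2"
  by (simp_all add: lin2_def)

lemma linear_lin2: "linear (lin2 a b c d)"
  by (rule linearI) (simp_all add: vec2_eq_iff algebra_simps)

lemma plane_rotation_lin2: "plane_rotation t = lin2 (cos t) (- sin t) (sin t) (cos t)"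
  by (rule ext) (simp add: plane_rotation_def lin2_def)

lemma plane_reflection_lin2:
  "plane_reflection t = lin2 (cos (2 * t)) (sin (2 * t)) (sin (2 * t)) (- cos (2 * t))"
  by (rule ext) (simp add: plane_reflection_def lin2_def)

lemma norm_lin2:
  assumes "a ^ 2 + c ^ 2 = 1" "b ^ 2 + d ^ 2 = 1" "a * b + c * d = 0"
  shows "norm (lin2 a b c d u) = norm u"
proof -
  have "(a * u$1 + b * u$2) ^ 2 + (c * u$1 + d * u$2) ^ 2 =
      (a ^ 2 + c ^ 2) * u$1 ^ 2 + (b ^ 2 + d ^ 2) * u$2 ^ 2 + 2 * (a * b + c * d) * (u$1 * u$2)"
    by algebra
  then show ?thesis by (simp add: norm_eq_sqrt_inner inner_vec2 assms flip: power2_eq_square)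
qed

lemma orthogonal_transformation_plane:
  "orthogonal_transformation (plane_rotation t)" "orthogonal_transformation (plane_reflection t)"
  unfolding orthogonal_transformation plane_rotation_lin2 plane_reflection_lin2
  by (simp_all add: linear_lin2 norm_lin2)

text \<open>The first column is a unit vector \<open>(cos t, sin t)\<close>; the second is the first
  turned by a right angle and multiplied by the determinant, which is 1 or -1.\<close>

lemma orthogonal_transformation_plane_cases:
  assumes "orthogonal_transformation f"
  obtains t where "f = plane_rotation t" | t where "f = plane_reflection t"
proof -
  have lin: "linear f" and inner: "\<And>v w. f v \<bullet> f w = v \<bullet> w"
    using assms by (simp_all add: orthogonal_transformation_def)
  let ?e1 = "vector [1, 0] :: real^2" and ?e2 = "vector [0, 1] :: real^2"
  define a c b d where "a = f ?e1 $ 1" "c = f ?e1 $ 2" "b = f ?e2 $ 1" "d = f ?e2 $ 2"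
  note abcd = this
  have 1: "a ^ 2 + c ^ 2 = 1" "b ^ 2 + d ^ 2 = 1" "a * b + c * d = 0"
    using inner[of ?e1 ?e1] inner[of ?e2 ?e2] inner[of ?e1 ?e2]
    by (simp_all add: inner_vec2 abcd power2_eq_square)
  have f: "f = lin2 a b c d"
  proof
    fix u
    have "u = u$1 *\<^sub>R ?e1 + u$2 *\<^sub>R ?e2" by (simp add: vec2_eq_iff)
    then have "f u = u$1 *\<^sub>R f ?e1 + u$2 *\<^sub>R f ?e2"
      by (metis linear_add[OF lin] linear_scale[OF lin])
    then show "f u = lin2 a b c d u" by (simp add: vec2_eq_iff abcd)
  qed
  obtain t where t: "a = cos t" "c = sin t" using sincos_total_2pi[OF 1(1)] by metis
  have "b = (a ^ 2 + c ^ 2) * b" "d = (a ^ 2 + c ^ 2) * d" using 1 by simp_all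
  then have bd: "b = - c * (a * d - b * c)" "d = a * (a * d - b * c)" using 1(3) by algebra+
  have "(a * d - b * c) ^ 2 = 1" using 1 by algebra
  then consider "a * d - b * c = 1" | "a * d - b * c = - 1" by (auto simp: power2_eq_1_iff)
  then show thesis
  proof cases
    case 1
    with bd t have "b = - sin t" "d = cos t" by simp_all
    then show ?thesis using that(1)[of t] f t by (simp add: plane_rotation_lin2)
  next
    case 2
    with bd t have "b = sin t" "d = - cos t" by simp_all
    \<comment> \<open>The angle is halved because a mirror at angle \<open>t\<close> has matrix
      entries in \<open>2 * t\<close>.\<close>
    then show ?thesis using that(2)[of "t / 2"] f t by (simp add: plane_reflection_lin2)
  qed
qed

lemma point_group_comp: "f \<in> point_group \<Lambda> \<Longrightarrow> g \<in> point_group \<Lambda> \<Longrightarrow> f \<circ> g \<in> point_group \<Lambda>"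
  unfolding point_group_def mem_Collect_eq
  by (metis image_comp orthogonal_transformation_compose)

lemma point_group_lattice_isometry: "f \<in> point_group \<Lambda> \<Longrightarrow> lattice_isometry \<Lambda> f"
  by (simp add: point_group_def lattice_isometry_def orthogonal_transformation)

lemma lattice_image_subset:
  assumes "lattice_basis \<Lambda> v w" "linear f" "f v \<in> \<Lambda>" "f w \<in> \<Lambda>"
  shows "f ` \<Lambda> \<subseteq> \<Lambda>"
proof
  fix z assume "z \<in> f ` \<Lambda>"
  then obtain u where u: "u \<in> \<Lambda>" "z = f u" by blast
  obtain m n :: int where mn: "u = of_int m *\<^sub>R v + of_int n *\<^sub>R w" using assms(1) u(1) by (rule lattice_basisE)
  obtain i j :: int where ij: "f v = of_int i *\<^sub>R v + of_int j *\<^sub>R w" using assms(1,3) by (rule lattice_basisE)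
  obtain k l :: int where kl: "f w = of_int k *\<^sub>R v + of_int l *\<^sub>R w" using assms(1,4) by (rule lattice_basisE)
  have "z = of_int m *\<^sub>R f v + of_int n *\<^sub>R f w"
    unfolding u(2) mn using assms(2) by (simp add: linear_add linear_scale)
  also have "\<dots> = of_int (m * i + n * k) *\<^sub>R v + of_int (m * j + n * l) *\<^sub>R w"
    unfolding ij kl by (simp add: algebra_simps)
  finally show "z \<in> \<Lambda>" by (rule lattice_basis_memI[OF assms(1)])
qed

lemma point_groupI:
  assumes "orthogonal_transformation f" "f ` \<Lambda> \<subseteq> \<Lambda>" "g ` \<Lambda> \<subseteq> \<Lambda>" "\<And>u. f (g u) = u"
  shows "f \<in> point_group \<Lambda>"
proof -
  have "\<Lambda> \<subseteq> f ` \<Lambda>" using assms(3,4) by (metis image_eqI image_subset_iff subsetI)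
  with assms show ?thesis by (simp add: point_group_def)
qed

lemma plane_reflection_involution: "plane_reflection t (plane_reflection t u) = u"
proof -
  have s: "sin (2 * t) ^ 2 = 1 - cos (2 * t) ^ 2" by (simp add: sin_squared_eq)
  show ?thesis unfolding vec2_eq_iff plane_reflection_lin2
    using s by (simp, algebra)
qed

lemma plane_reflection_nontrivial:
  "\<exists>u. plane_reflection t u \<noteq> u" "\<exists>u. plane_reflection t u \<noteq> - u"
proof -
  let ?e1 = "vector [1, 0] :: real^2" and ?e2 = "vector [0, 1] :: real^2"
  have "plane_reflection t ?e1 \<noteq> ?e1 \<or> plane_reflection t ?e2 \<noteq> ?e2"
    "plane_reflection t ?e1 \<noteq> - ?e1 \<or> plane_reflection t ?e2 \<noteq> - ?e2"
    by (auto simp: plane_reflection_lin2 vec2_eq_iff)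
  then show "\<exists>u. plane_reflection t u \<noteq> u" "\<exists>u. plane_reflection t u \<noteq> - u" by blast+
qed

lemma plane_rotation_add: "plane_rotation a \<circ> plane_rotation b = plane_rotation (a + b)"
  by (rule ext) (simp add: plane_rotation_lin2 vec2_eq_iff cos_add sin_add algebra_simps)

lemma plane_rotation_reflection:
  "plane_rotation (2 * a) \<circ> plane_reflection t = plane_reflection (t + a)"
  by (rule ext) (simp add: plane_rotation_lin2 plane_reflection_lin2 vec2_eq_iff
    distrib_left cos_add sin_add algebra_simps)

lemma plane_reflection_reflection:
  "plane_reflection a \<circ> plane_reflection b = plane_rotation (2 * a - 2 * b)"
  by (rule ext) (simp add: plane_rotation_lin2 plane_reflection_lin2 vec2_eq_iff
    cos_diff sin_diff algebra_simps)

lemma plane_rotation_0: "plane_rotation 0 = id"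
  by (rule ext) (simp add: plane_rotation_lin2 vec2_eq_iff)

lemma plane_rotation_eqI: "cos a = cos b \<Longrightarrow> sin a = sin b \<Longrightarrow> plane_rotation a = plane_rotation b"
  by (simp add: plane_rotation_lin2)

text \<open>Crystallographic restriction: the trace of a rotation preserving a lattice is an integer,
  and by Cayley-Hamilton the rotations of trace 0 and \<open>\<plusminus>1\<close> yield maps with \<open>f\<^sup>2 = -1\<close> and
  \<open>f\<^sup>2 = f - 1\<close>.\<close>

lemma rotation_in_point_group_cases:
  assumes L: "is_lattice \<Lambda>" and r: "plane_rotation t \<in> point_group \<Lambda>"
  obtains "\<bar>cos t\<bar> = 1" | "cos t = 0" "PI \<Lambda> = (0, 0)" | "\<bar>cos t\<bar> = 1 / 2" "PI \<Lambda> = (0, 1)"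
proof -
  obtain v w where b: "lattice_basis \<Lambda> v w" using L unfolding is_lattice_def by blast
  have d: "det2 v w \<noteq> 0" using b by (simp add: lattice_basis_iff)
  let ?f = "plane_rotation t"
  have iso: "lattice_isometry \<Lambda> ?f" by (rule point_group_lattice_isometry[OF r])
  then have "?f v \<in> \<Lambda>" "?f w \<in> \<Lambda>" using lattice_basis_vectors[OF b] by (auto simp: lattice_isometry_def)
  \<comment> \<open>The sum of the diagonal coordinates in the basis \<open>v\<close>,
    \<open>w\<close> is the trace.\<close>
  then have "det2 (?f v) w / det2 v w + det2 v (?f w) / det2 v w \<in> \<int>"
    using lattice_mem_iff_det2[OF b] by (blast intro: Ints_add)
  also have "det2 (?f v) w / det2 v w + det2 v (?f w) / det2 v w = 2 * cos t"
    using d unfolding add_divide_distrib[symmetric]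
    by (simp add: det2_def plane_rotation_lin2 field_simps)
  finally obtain k :: int where k: "2 * cos t = of_int k" by (auto elim: Ints_cases)
  have "-1 \<le> cos t" "cos t \<le> 1" by simp_all
  then have "real_of_int (- 2) \<le> of_int k" "of_int k \<le> real_of_int 2" unfolding k[symmetric] by simp_all
  then have "k \<in> {-2..2}" by (simp only: of_int_le_iff) simp
  then have "k \<in> {-2, -1, 0, 1, 2}" by auto
  then consider "\<bar>cos t\<bar> = 1" | "cos t = 0" | "cos t = 1 / 2" | "cos t = - 1 / 2" using k by force
  moreover have CH: "?f (?f u) = (2 * cos t) *\<^sub>R ?f u - u" for u
    using sin_squared_eq[of t] unfolding vec2_eq_iff plane_rotation_lin2
    by (simp, algebra)
  ultimately show thesis
  proof cases
    case 1
    then show ?thesis by (rule that(1))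
  next
    case 2
    with CH have "?f (?f u) = - u" for u by simp
    then show ?thesis using that(2)[OF 2] quarter_turn_PI[OF L iso] by blast
  next
    case 3
    with CH have "?f (?f u) = ?f u - u" for u by simp
    then show ?thesis using that(3) 3 sixth_turn_PI[OF L iso] by simp
  next
    case 4
    \<comment> \<open>For trace -1 the sixth-turn relation holds for the negative of the
      rotation.\<close>
    have "linear ?f" using iso by (simp add: lattice_isometry_def)
    then have "- ?f (- ?f u) = - ?f u - u" for u using CH[of u] 4 by (simp add: linear_neg)
    moreover have "lattice_isometry \<Lambda> (\<lambda>u. - ?f u)"
      using iso lattice_uminus[OF L] unfolding lattice_isometry_def
      by (auto intro: linear_compose_neg)
    ultimately show ?thesis using that(3) 4 sixth_turn_PI[OF L] by simp
  qed
qed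

text \<open>A reflection of the group composed with the given one is a rotation of the group, hence
  listed; composing back exhibits it as a listed reflection. Rotations are compared as maps because
  angles are determined only modulo \<open>2 * pi\<close>.\<close>

lemma point_group_eq_dihedral:
  assumes n: "0 < n" and refl: "plane_reflection t \<in> point_group \<Lambda>"
    and rot: "plane_rotation (2 * pi / real n) \<in> point_group \<Lambda>"
    and only: "\<And>s. plane_rotation s \<in> point_group \<Lambda> \<Longrightarrow>
      \<exists>k<n. plane_rotation s = plane_rotation (2 * pi * real k / real n)"
  shows "point_group \<Lambda> = dihedral_group n t"
proof (intro subset_antisym subsetI)
  have id: "id \<in> point_group \<Lambda>" by (simp add: point_group_def orthogonal_transformation linear_id)
  have rots: "plane_rotation (2 * pi * real k / real n) \<in> point_group \<Lambda>" for k
  proof (induction k)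
    case 0
    then show ?case using id unfolding plane_rotation_0[symmetric] by simp
  next
    case (Suc k)
    have "2 * pi / real n + 2 * pi * real k / real n = 2 * pi * real (Suc k) / real n"
      by (simp add: add_divide_distrib[symmetric] algebra_simps)
    then show ?case using point_group_comp[OF rot Suc] by (simp add: plane_rotation_add)
  qed
  have rr: "plane_rotation (2 * pi * real k / real n) \<circ> plane_reflection t =
      plane_reflection (t + pi * real k / real n)" for k
    using plane_rotation_reflection[of "pi * real k / real n" t] by (simp add: mult.assoc)
  fix f
  show "f \<in> point_group \<Lambda>" if "f \<in> dihedral_group n t"
    using that rots point_group_comp[OF rots refl] unfolding dihedral_group_def rr by auto
  assume f: "f \<in> point_group \<Lambda>"
  then have "orthogonal_transformation f" by (simp add: point_group_def)
  then show "f \<in> dihedral_group n t"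
  proof (cases rule: orthogonal_transformation_plane_cases)
    case (1 s)
    then show ?thesis using only f unfolding dihedral_group_def by blast
  next
    case (2 s)
    have "plane_rotation (2 * s - 2 * t) \<in> point_group \<Lambda>"
      using point_group_comp[OF f refl] unfolding 2 plane_reflection_reflection .
    from only[OF this] obtain k where k: "k < n"
      "plane_reflection s \<circ> plane_reflection t = plane_rotation (2 * pi * real k / real n)"
      unfolding plane_reflection_reflection by blast
    have "f = (plane_reflection s \<circ> plane_reflection t) \<circ> plane_reflection t"
      unfolding 2 by (rule ext) (simp add: plane_reflection_involution)
    then have "f = plane_reflection (t + pi * real k / real n)" unfolding k rr .
    with k(1) show ?thesis unfolding dihedral_group_def by blast
  qed
qed

text \<open>The two excluded values of \<open>PI\<close> are those forced by rotations other than
  the identity and its negative.\<close>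

lemma has_point_group_D2:
  assumes L: "is_lattice \<Lambda>" and refl: "plane_reflection t \<in> point_group \<Lambda>"
    and PI: "PI \<Lambda> \<noteq> (0, 0)" "PI \<Lambda> \<noteq> (0, 1)"
  shows "has_point_group_D 2 \<Lambda>"
proof -
  have "plane_rotation pi = uminus" by (rule ext) (simp add: plane_rotation_lin2 vec2_eq_iff)
  moreover have "uminus \<in> point_group \<Lambda>"
    by (rule point_groupI[where g = uminus])
      (use lattice_uminus[OF L] in \<open>auto simp: orthogonal_transformation linear_iff\<close>)
  ultimately have rot: "plane_rotation (2 * pi / real 2) \<in> point_group \<Lambda>" by simp
  have only: "\<exists>k<2. plane_rotation s = plane_rotation (2 * pi * real k / real 2)"
    if "plane_rotation s \<in> point_group \<Lambda>" for s
    using L that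
  proof (cases rule: rotation_in_point_group_cases)
    case 1
    then have c: "cos s = 1 \<or> cos s = - 1" by linarith
    then have s: "sin s = 0" using sin_cos_squared_add3[of s] by (elim disjE) simp_all
    from c s have "plane_rotation s = plane_rotation (2 * pi * real 0 / real 2) \<or>
        plane_rotation s = plane_rotation (2 * pi * real 1 / real 2)"
      by (elim disjE) (auto intro!: plane_rotation_eqI simp del: One_nat_def)
    then show ?thesis by (metis less_2_cases_iff One_nat_def)
  qed (use PI in auto)
  show ?thesis unfolding has_point_group_D_def
    using point_group_eq_dihedral[OF _ refl rot only] by auto
qed

text \<open>The value of \<open>PI\<close> rules out rotations with cosine 1/2 or -1/2, leaving the
  four quarter turns.\<close>

lemma has_point_group_D4:
  assumes L: "is_lattice \<Lambda>" and refl: "plane_reflection t \<in> point_group \<Lambda>"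
    and PI: "PI \<Lambda> = (0, 0)" and r: "plane_rotation (pi / 2) \<in> point_group \<Lambda>"
  shows "has_point_group_D 4 \<Lambda>"
proof -
  have rot: "plane_rotation (2 * pi / real 4) \<in> point_group \<Lambda>" using r by simp
  have q3: "cos (3 * pi / 2) = 0" "sin (3 * pi / 2) = - 1"
    using cos_periodic_pi[of "pi / 2"] sin_periodic_pi[of "pi / 2"] by (simp_all add: field_simps)
  have only: "\<exists>k<4. plane_rotation s = plane_rotation (2 * pi * real k / real 4)"
    if "plane_rotation s \<in> point_group \<Lambda>" for s
  proof -
    from L that have "cos s = 0 \<or> \<bar>cos s\<bar> = 1"
      by (cases rule: rotation_in_point_group_cases) (use PI in auto)
    then have "(cos s = 0 \<and> sin s = 1) \<or> (cos s = 0 \<and> sin s = -1) \<or>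
        (cos s = 1 \<and> sin s = 0) \<or> (cos s = -1 \<and> sin s = 0)"
    proof
      assume c: "cos s = 0"
      then have "sin s ^ 2 = 1" using sin_squared_eq[of s] by simp
      with c show ?thesis by (auto simp: power2_eq_1_iff)
    next
      assume c: "\<bar>cos s\<bar> = 1"
      then have "cos s = 1 \<or> cos s = - 1" by linarith
      moreover from this have "sin s ^ 2 = 0" using sin_squared_eq[of s] by auto
      ultimately show ?thesis by auto
    qed
    then have "plane_rotation s \<in> (\<lambda>k. plane_rotation (2 * pi * real k / real 4)) ` {0, 1, 2, 3}"
      by (auto intro!: plane_rotation_eqI simp: q3 mult.commute[of pi 3])
    then show ?thesis by force
  qed
  show ?thesis unfolding has_point_group_D_def
    using point_group_eq_dihedral[OF _ refl rot only] by auto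
qed

text \<open>The value of \<open>PI\<close> rules out rotations with cosine 0, leaving the multiples
  of a sixth turn.\<close>

lemma has_point_group_D6:
  assumes L: "is_lattice \<Lambda>" and refl: "plane_reflection t \<in> point_group \<Lambda>"
    and PI: "PI \<Lambda> = (0, 1)" and r: "plane_rotation (pi / 3) \<in> point_group \<Lambda>"
  shows "has_point_group_D 6 \<Lambda>"
proof -
  have rot: "plane_rotation (2 * pi / real 6) \<in> point_group \<Lambda>" using r by simp
  have ang: "cos (2 * pi * real 1 / real 6) = 1 / 2" "sin (2 * pi * real 1 / real 6) = sqrt 3 / 2"
    "cos (2 * pi * real 2 / real 6) = - 1 / 2" "sin (2 * pi * real 2 / real 6) = sqrt 3 / 2"
    "cos (2 * pi * real 4 / real 6) = - 1 / 2" "sin (2 * pi * real 4 / real 6) = - sqrt 3 / 2"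
    "cos (2 * pi * real 5 / real 6) = 1 / 2" "sin (2 * pi * real 5 / real 6) = - sqrt 3 / 2"
  proof -
    show "cos (2 * pi * real 1 / real 6) = 1 / 2" "sin (2 * pi * real 1 / real 6) = sqrt 3 / 2"
      using cos_60 sin_60 by simp_all
    have "2 * pi * real 2 / real 6 = pi - pi / 3" by simp
    then show "cos (2 * pi * real 2 / real 6) = - 1 / 2" "sin (2 * pi * real 2 / real 6) = sqrt 3 / 2"
      using cos_60 sin_60 by (simp_all only: cos_pi_minus sin_pi_minus)
    have "2 * pi * real 4 / real 6 = pi / 3 + pi" by simp
    then show "cos (2 * pi * real 4 / real 6) = - 1 / 2" "sin (2 * pi * real 4 / real 6) = - sqrt 3 / 2"
      using cos_60 sin_60 by (simp_all only: cos_periodic_pi sin_periodic_pi)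
    have "2 * pi * real 5 / real 6 = 2 * pi - pi / 3" by simp
    then show "cos (2 * pi * real 5 / real 6) = 1 / 2" "sin (2 * pi * real 5 / real 6) = - sqrt 3 / 2"
      using cos_60 sin_60 by (simp_all only: cos_2pi_minus sin_2pi_minus)
  qed
  have only: "\<exists>k<6. plane_rotation s = plane_rotation (2 * pi * real k / real 6)"
    if "plane_rotation s \<in> point_group \<Lambda>" for s
  proof -
    from L that have "\<bar>cos s\<bar> = 1 / 2 \<or> \<bar>cos s\<bar> = 1"
      by (cases rule: rotation_in_point_group_cases) (use PI in auto)
    then consider "\<bar>cos s\<bar> = 1 / 2" | "\<bar>cos s\<bar> = 1" by blast
    then have "(cos s = 1 / 2 \<or> cos s = - 1 / 2) \<and> (sin s = sqrt 3 / 2 \<or> sin s = - sqrt 3 / 2) \<or>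
        (cos s = 1 \<or> cos s = -1) \<and> sin s = 0"
    proof cases
      case 1
      then have "cos s ^ 2 = (1 / 2) ^ 2" by (metis power2_abs)
      then have "sin s ^ 2 = (sqrt 3 / 2) ^ 2" unfolding sin_squared_eq by (simp add: power_divide)
      then have "sin s = sqrt 3 / 2 \<or> sin s = - (sqrt 3 / 2)" by (simp only: power2_eq_iff)
      with 1 show ?thesis by (auto simp: abs_if split: if_splits)
    next
      case 2
      then have c: "cos s = 1 \<or> cos s = - 1" by linarith
      then have "sin s ^ 2 = 0" using sin_squared_eq[of s] by auto
      with c show ?thesis by simp
    qed
    then consider "cos s = cos (2 * pi * real 1 / real 6) \<and> sin s = sin (2 * pi * real 1 / real 6)"
      | "cos s = cos (2 * pi * real 2 / real 6) \<and> sin s = sin (2 * pi * real 2 / real 6)"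
      | "cos s = cos (2 * pi * real 4 / real 6) \<and> sin s = sin (2 * pi * real 4 / real 6)"
      | "cos s = cos (2 * pi * real 5 / real 6) \<and> sin s = sin (2 * pi * real 5 / real 6)"
      | "cos s = cos (2 * pi * real 0 / real 6) \<and> sin s = sin (2 * pi * real 0 / real 6)"
      | "cos s = cos (2 * pi * real 3 / real 6) \<and> sin s = sin (2 * pi * real 3 / real 6)"
      unfolding ang by fastforce
    then have "\<exists>k\<in>{0, 1, 2, 3, 4, 5}. plane_rotation s = plane_rotation (2 * pi * real k / real 6)"
      by cases (use plane_rotation_eqI in blast)+
    then show ?thesis by force
  qed
  show ?thesis unfolding has_point_group_D_def
    using point_group_eq_dihedral[OF _ refl rot only] by auto
qed

section \<open>The subspaces of symmetric lattices\<close>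

lemma tendsto_det2:
  assumes "(v \<longlongrightarrow> v') F" "(w \<longlongrightarrow> w') F"
  shows "((\<lambda>n. det2 (v n) (w n)) \<longlongrightarrow> det2 v' w') F"
  unfolding det2_def by (intro tendsto_intros assms)

lemma tendsto_lin2:
  assumes "(a \<longlongrightarrow> a') F" "(b \<longlongrightarrow> b') F" "(c \<longlongrightarrow> c') F" "(d \<longlongrightarrow> d') F" "(u \<longlongrightarrow> u') F"
  shows "((\<lambda>n. lin2 (a n) (b n) (c n) (d n) (u n)) \<longlongrightarrow> lin2 a' b' c' d' u') F"
proof (rule vec_tendstoI)
  fix i :: 2
  have "i = 1 \<or> i = 2" by (rule exhaust_2)
  then show "((\<lambda>n. lin2 (a n) (b n) (c n) (d n) (u n) $ i) \<longlongrightarrow> lin2 a' b' c' d' u' $ i) F"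
    by (elim disjE) (auto intro!: tendsto_intros assms)
qed

text \<open>The coordinates of the image of a lattice vector with respect to the basis are integers,
  and so are their limits.\<close>

lemma lattice_symmetry_limit:
  assumes b: "lattice_basis \<Lambda> v w" and bn: "\<And>n::nat. lattice_basis (\<Lambda>n n) (vn n) (wn n)"
    and v: "vn \<longlonglongrightarrow> v" and w: "wn \<longlonglongrightarrow> w"
    and lim: "a \<longlonglongrightarrow> a'" "b \<longlonglongrightarrow> b'" "c \<longlonglongrightarrow> c'" "d \<longlonglongrightarrow> d'"
    and im: "\<And>n. lin2 (a n) (b n) (c n) (d n) ` \<Lambda>n n \<subseteq> \<Lambda>n n"
  shows "lin2 a' b' c' d' ` \<Lambda> \<subseteq> \<Lambda>"
proof
  fix z assume "z \<in> lin2 a' b' c' d' ` \<Lambda>"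
  then obtain u where u: "u \<in> \<Lambda>" "z = lin2 a' b' c' d' u" by blast
  obtain m k :: int where mk: "u = of_int m *\<^sub>R v + of_int k *\<^sub>R w" using b u(1) by (rule lattice_basisE)
  define zn where "zn n = lin2 (a n) (b n) (c n) (d n) (of_int m *\<^sub>R vn n + of_int k *\<^sub>R wn n)" for n
  have z: "zn \<longlonglongrightarrow> z" unfolding zn_def u(2) mk by (intro tendsto_lin2 lim tendsto_intros v w)
  have "zn n \<in> \<Lambda>n n" for n unfolding zn_def using im lattice_basis_mem[OF bn] by blast
  then have int: "det2 (zn n) (wn n) / det2 (vn n) (wn n) \<in> \<int>" "det2 (vn n) (zn n) / det2 (vn n) (wn n) \<in> \<int>" for n
    using lattice_mem_iff_det2[OF bn] by blast+
  have "det2 v w \<noteq> 0" using b by (simp add: lattice_basis_iff)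
  then have "(\<lambda>n. det2 (zn n) (wn n) / det2 (vn n) (wn n)) \<longlonglongrightarrow> det2 z w / det2 v w"
    "(\<lambda>n. det2 (vn n) (zn n) / det2 (vn n) (wn n)) \<longlonglongrightarrow> det2 v z / det2 v w"
    by (intro tendsto_divide tendsto_det2 z v w; assumption)+
  then have "det2 z w / det2 v w \<in> \<int>" "det2 v z / det2 v w \<in> \<int>"
    using closed_sequentially[OF closed_Ints int(1)] closed_sequentially[OF closed_Ints int(2)] by simp_all
  then show "z \<in> \<Lambda>" using lattice_mem_iff_det2[OF b] by blast
qed

text \<open>The mirror angles \<open>t n\<close> vary with the approximating lattices and need not
  converge.\<close>

lemma LIS_sequence:
  assumes "\<Lambda> \<in> LIS k"
  obtains v w vn wn \<Lambda>n t where "lattice_basis \<Lambda> v w" "vn \<longlonglongrightarrow> v" "wn \<longlonglongrightarrow> w"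
    "\<And>n::nat. lattice_basis (\<Lambda>n n) (vn n) (wn n)" "\<And>n. point_group (\<Lambda>n n) = dihedral_group k (t n)"
proof -
  obtain v w where b: "lattice_basis \<Lambda> v w" and
    "(v, w) \<in> closure {(v', w'). \<exists>\<Lambda>'. lattice_basis \<Lambda>' v' w' \<and> has_point_group_D k \<Lambda>'}"
    using assms unfolding LIS_def by blast
  then obtain x where x: "\<And>n. x n \<in> {(v', w'). \<exists>\<Lambda>'. lattice_basis \<Lambda>' v' w' \<and> has_point_group_D k \<Lambda>'}"
    and lim: "x \<longlonglongrightarrow> (v, w)" unfolding closure_sequential by blast
  have "\<forall>n. \<exists>L t. lattice_basis L (fst (x n)) (snd (x n)) \<and> point_group L = dihedral_group k t"
  proof
    fix n
    show "\<exists>L t. lattice_basis L (fst (x n)) (snd (x n)) \<and> point_group L = dihedral_group k t"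
      using x[of n] unfolding has_point_group_D_def by fastforce
  qed
  then obtain \<Lambda>n t where bn: "\<And>n. lattice_basis (\<Lambda>n n) (fst (x n)) (snd (x n))"
    and tn: "\<And>n. point_group (\<Lambda>n n) = dihedral_group k (t n)" by metis
  show thesis
    by (rule that[OF b _ _ bn tn]) (use tendsto_fst[OF lim] tendsto_snd[OF lim] in simp_all)
qed

lemma LIS_lattice: "\<Lambda> \<in> LIS k \<Longrightarrow> is_lattice \<Lambda>"
  unfolding LIS_def is_lattice_def by blast

lemma LIS_rotation:
  assumes "\<Lambda> \<in> LIS k" "2 \<le> k"
  shows "plane_rotation (2 * pi / real k) ` \<Lambda> \<subseteq> \<Lambda>"
proof -
  obtain v w vn wn \<Lambda>n t where *: "lattice_basis \<Lambda> v w" "vn \<longlonglongrightarrow> v" "wn \<longlonglongrightarrow> w"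
    "\<And>n::nat. lattice_basis (\<Lambda>n n) (vn n) (wn n)" "\<And>n. point_group (\<Lambda>n n) = dihedral_group k (t n)"
    using assms(1) by (rule LIS_sequence) blast
  \<comment> \<open>It is the rotation of index 1, which is listed only when
    \<open>1 < k\<close>.\<close>
  have "plane_rotation (2 * pi / real k) \<in> dihedral_group k (t n)" for n
    unfolding dihedral_group_def using assms(2) by (intro UnI1 CollectI exI[of _ 1]) simp
  then have "plane_rotation (2 * pi / real k) ` \<Lambda>n n \<subseteq> \<Lambda>n n" for n
    unfolding *(5)[symmetric] by (simp add: point_group_def)
  then show ?thesis
    unfolding plane_rotation_lin2
    by (rule lattice_symmetry_limit[OF *(1,4,2,3) tendsto_const tendsto_const tendsto_const tendsto_const])
qed

text \<open>The unit circle is compact, so along a subsequence the matrix entries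
  \<open>(cos (2 * t n), sin (2 * t n))\<close> converge, and their limit again belongs to a
  reflection.\<close>

lemma LIS_reflection:
  assumes "\<Lambda> \<in> LIS 2"
  shows "\<exists>t. plane_reflection t ` \<Lambda> \<subseteq> \<Lambda>"
proof -
  obtain v w vn wn \<Lambda>n t where *: "lattice_basis \<Lambda> v w" "vn \<longlonglongrightarrow> v" "wn \<longlonglongrightarrow> w"
    "\<And>n::nat. lattice_basis (\<Lambda>n n) (vn n) (wn n)" "\<And>n. point_group (\<Lambda>n n) = dihedral_group 2 (t n)"
    using assms by (rule LIS_sequence) blast
  have "plane_reflection (t n) \<in> dihedral_group 2 (t n)" for n
    unfolding dihedral_group_def by (intro UnI2 CollectI exI[of _ 0]) simp
  then have im: "plane_reflection (t n) ` \<Lambda>n n \<subseteq> \<Lambda>n n" for n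
    unfolding *(5)[symmetric] by (simp add: point_group_def)
  define p where "p n = (cos (2 * t n), sin (2 * t n))" for n
  have "\<forall>n. p n \<in> sphere 0 1" by (simp add: p_def norm_Pair)
  then obtain l r where "l \<in> sphere 0 1" and r: "strict_mono r" and l: "(p \<circ> r) \<longlonglongrightarrow> l"
    using compact_sphere[of "0 :: real \<times> real" 1] unfolding compact_def by blast
  then have "fst l ^ 2 + snd l ^ 2 = 1" by (cases l) (simp add: norm_Pair)
  then obtain s where s: "fst l = cos s" "snd l = sin s" using sincos_total_2pi by metis
  have lim: "(\<lambda>n. cos (2 * t (r n))) \<longlonglongrightarrow> cos (2 * (s / 2))" "(\<lambda>n. sin (2 * t (r n))) \<longlonglongrightarrow> sin (2 * (s / 2))"
    using tendsto_fst[OF l] tendsto_snd[OF l] by (simp_all add: p_def s)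
  have "plane_reflection (s / 2) ` \<Lambda> \<subseteq> \<Lambda>"
    unfolding plane_reflection_lin2
  proof (rule lattice_symmetry_limit[OF *(1)])
    show "lattice_basis (\<Lambda>n (r n)) ((vn \<circ> r) n) ((wn \<circ> r) n)" for n using *(4) by simp
    show "(vn \<circ> r) \<longlonglongrightarrow> v" "(wn \<circ> r) \<longlonglongrightarrow> w"
      by (rule LIMSEQ_subseq_LIMSEQ[OF *(2) r], rule LIMSEQ_subseq_LIMSEQ[OF *(3) r])
    show "lin2 (cos (2 * t (r n))) (sin (2 * t (r n))) (sin (2 * t (r n))) (- cos (2 * t (r n))) ` \<Lambda>n (r n) \<subseteq> \<Lambda>n (r n)" for n
      using im[of "r n"] unfolding plane_reflection_lin2 .
  qed (rule lim tendsto_minus[OF lim(1)])+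
  then show ?thesis by blast
qed

lemma lattice_isometry_plane:
  "plane_rotation t ` \<Lambda> \<subseteq> \<Lambda> \<Longrightarrow> lattice_isometry \<Lambda> (plane_rotation t)"
  "plane_reflection t ` \<Lambda> \<subseteq> \<Lambda> \<Longrightarrow> lattice_isometry \<Lambda> (plane_reflection t)"
  using orthogonal_transformation_plane[of t]
  by (simp_all add: lattice_isometry_def orthogonal_transformation)

lemma LIS_2_PI:
  assumes "\<Lambda> \<in> LIS 2" "PI \<Lambda> = (x, y)"
  shows "x = 0 \<or> y = 0 \<or> x + y = 1"
proof -
  obtain t where "plane_reflection t ` \<Lambda> \<subseteq> \<Lambda>" using LIS_reflection[OF assms(1)] by blast
  then have iso: "lattice_isometry \<Lambda> (plane_reflection t)" by (rule lattice_isometry_plane)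
  obtain u u' where "plane_reflection t u \<noteq> u" "plane_reflection t u' \<noteq> - u'"
    using plane_reflection_nontrivial by blast
  then show ?thesis
    using reflection_PI[OF LIS_lattice[OF assms(1)] iso plane_reflection_involution _ _ assms(2)] by blast
qed

lemma quarter_turn_twice: "plane_rotation (pi / 2) (plane_rotation (pi / 2) u) = - u"
  by (simp add: plane_rotation_lin2 vec2_eq_iff)

lemma sixth_turn_twice: "plane_rotation (pi / 3) (plane_rotation (pi / 3) u) = plane_rotation (pi / 3) u - u"
  by (simp add: plane_rotation_lin2 vec2_eq_iff cos_60 sin_60 algebra_simps)

lemma LIS_4_PI:
  assumes "\<Lambda> \<in> LIS 4"
  shows "PI \<Lambda> = (0, 0)"
proof -
  have "plane_rotation (pi / 2) ` \<Lambda> \<subseteq> \<Lambda>" using LIS_rotation[OF assms] by simp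
  then show ?thesis
    by (rule quarter_turn_PI[OF LIS_lattice[OF assms] lattice_isometry_plane(1) quarter_turn_twice])
qed

lemma LIS_6_PI:
  assumes "\<Lambda> \<in> LIS 6"
  shows "PI \<Lambda> = (0, 1)"
proof -
  have "plane_rotation (pi / 3) ` \<Lambda> \<subseteq> \<Lambda>" using LIS_rotation[OF assms] by simp
  then show ?thesis
    by (rule sixth_turn_PI[OF LIS_lattice[OF assms] lattice_isometry_plane(1) sixth_turn_twice])
qed

lemma LISI:
  assumes "lattice_basis \<Lambda> v w" "has_point_group_D k \<Lambda>"
  shows "\<Lambda> \<in> LIS k"
proof -
  have "(v, w) \<in> {(v', w'). \<exists>\<Lambda>'. lattice_basis \<Lambda>' v' w' \<and> has_point_group_D k \<Lambda>'}" using assms by blast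
  then have "(v, w) \<in> closure {(v', w'). \<exists>\<Lambda>'. lattice_basis \<Lambda>' v' w' \<and> has_point_group_D k \<Lambda>'}"
    by (rule subsetD[OF closure_subset])
  with assms(1) show ?thesis unfolding LIS_def by blast
qed

section \<open>Lattices with prescribed products\<close>

definition generated_lattice :: "real^2 \<Rightarrow> real^2 \<Rightarrow> (real^2) set" where
  "generated_lattice v w = {of_int m *\<^sub>R v + of_int n *\<^sub>R w | m n :: int. True}"

lemma lattice_basis_generated: "det2 v w \<noteq> 0 \<Longrightarrow> lattice_basis (generated_lattice v w) v w"
  unfolding lattice_basis_iff generated_lattice_def by blast

text \<open>Basis vectors of a superbase with \<open>- (v1 \<bullet> v2) = p\<close>, \<open>- (v0 \<bullet> v1) = q\<close>, \<open>- (v0 \<bullet> v2) = r\<close>.\<close>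

definition conorm_vec1 :: "real \<Rightarrow> real \<Rightarrow> real \<Rightarrow> real^2" where
  "conorm_vec1 p q r = vector [sqrt (p + q), 0]"

definition conorm_vec2 :: "real \<Rightarrow> real \<Rightarrow> real \<Rightarrow> real^2" where
  "conorm_vec2 p q r = vector [- p / sqrt (p + q), sqrt ((p * q + p * r + q * r) / (p + q))]"

definition conorm_lattice :: "real \<Rightarrow> real \<Rightarrow> real \<Rightarrow> (real^2) set" where
  "conorm_lattice p q r = generated_lattice (conorm_vec1 p q r) (conorm_vec2 p q r)"

text \<open>The first vector has squared length \<open>p + q\<close>. The second coordinate of
  \<open>v2\<close> gives it squared length \<open>p + r\<close>, because
  \<open>p ^ 2 + (p * q + p * r + q * r) = (p + q) * (p + r)\<close>; the bracket is the squared
  area of the cell.\<close>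

lemma conorm_lattice_superbase:
  fixes p q r :: real
  assumes "0 \<le> p" "p \<le> q" "q \<le> r" "0 < q"
  defines "v1 \<equiv> conorm_vec1 p q r" and "v2 \<equiv> conorm_vec2 p q r"
  shows "lattice_basis (conorm_lattice p q r) v1 v2"
    "obtuse_superbase (conorm_lattice p q r) (- v1 - v2) v1 v2"
    "v1 \<bullet> v2 = - p" "(- v1 - v2) \<bullet> v1 = - q" "(- v1 - v2) \<bullet> v2 = - r"
proof -
  have pq: "0 < p + q" and D: "0 < (p * q + p * r + q * r) / (p + q)"
    using assms by (auto intro!: divide_pos_pos add_nonneg_pos mult_pos_pos)
  have "det2 v1 v2 = sqrt (p + q) * sqrt ((p * q + p * r + q * r) / (p + q))"
    by (simp add: v1_def v2_def det2_def conorm_vec1_def conorm_vec2_def)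
  also have "\<dots> \<noteq> 0" using pq D by (metis less_irrefl mult_eq_0_iff real_sqrt_gt_zero)
  finally have "det2 v1 v2 \<noteq> 0" .
  then show b: "lattice_basis (conorm_lattice p q r) v1 v2"
    unfolding conorm_lattice_def v1_def v2_def by (rule lattice_basis_generated)
  show 12: "v1 \<bullet> v2 = - p"
    using pq by (simp add: v1_def v2_def inner_vec2 conorm_vec1_def conorm_vec2_def)
  have 11: "v1 \<bullet> v1 = p + q"
    using pq by (simp add: v1_def inner_vec2 conorm_vec1_def)
  have "v2 \<bullet> v2 = p ^ 2 / sqrt (p + q) ^ 2 + sqrt ((p * q + p * r + q * r) / (p + q)) ^ 2"
    unfolding v2_def inner_vec2 conorm_vec2_def by (simp add: power2_eq_square)
  also have "\<dots> = p ^ 2 / (p + q) + (p * q + p * r + q * r) / (p + q)"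
    unfolding real_sqrt_pow2[OF less_imp_le[OF pq]] real_sqrt_pow2[OF less_imp_le[OF D]] ..
  also have "\<dots> = p + r" using pq by (simp add: add_divide_distrib[symmetric] nonzero_divide_eq_eq power2_eq_square algebra_simps)
  finally have 22: "v2 \<bullet> v2 = p + r" .
  show 01: "(- v1 - v2) \<bullet> v1 = - q" and 02: "(- v1 - v2) \<bullet> v2 = - r"
    using 11 12 22 by (simp_all add: inner_diff_left inner_commute[of v2 v1])
  show "obtuse_superbase (conorm_lattice p q r) (- v1 - v2) v1 v2"
    unfolding obtuse_superbase_def superbase_def 12 01 02 using b assms by simp
qed

lemma conorm_lattice_PI:
  assumes "0 \<le> p" "p \<le> q" "q \<le> r" "0 < q"
  shows "PI (conorm_lattice p q r) =
    ((sqrt r - sqrt q) / (sqrt p + sqrt q + sqrt r), 3 * sqrt p / (sqrt p + sqrt q + sqrt r))"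
  using PI_eq[OF conorm_lattice_superbase(2)[OF assms]] assms
  by (simp add: conorm_lattice_superbase(3-5))

lemma is_lattice_conorm_lattice:
  assumes "0 \<le> p" "p \<le> q" "q \<le> r" "0 < q"
  shows "is_lattice (conorm_lattice p q r)"
  using conorm_lattice_superbase(1)[OF assms] by (rule lattice_basis_lattice)

lemma exists_lattice_with_PI:
  assumes "0 \<le> x" "x < 1" "0 \<le> y" "x + y \<le> 1"
  shows "\<exists>\<Lambda>. is_lattice \<Lambda> \<and> PI \<Lambda> = (x, y)"
proof -
  \<comment> \<open>The solution of \<open>3 * a = y\<close>, \<open>c - b = x\<close>,
    \<open>a + b + c = 1\<close>. These are root products, so their squares are the parameters of
    the lattice.\<close>
  define a b c where "a = y / 3" "b = (1 - y / 3 - x) / 2" "c = (1 - y / 3 + x) / 2"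
  have *: "0 \<le> a" "a \<le> b" "b \<le> c" "0 < b" and s: "a + b + c = 1"
    using assms unfolding a_b_c_def by argo+
  have sq: "0 \<le> a ^ 2" "a ^ 2 \<le> b ^ 2" "b ^ 2 \<le> c ^ 2" "0 < b ^ 2"
    using * by (auto intro: power_mono)
  have "c - b = x" "3 * a = y" unfolding a_b_c_def by argo+
  then have "PI (conorm_lattice (a ^ 2) (b ^ 2) (c ^ 2)) = (x, y)"
    unfolding conorm_lattice_PI[OF sq] using * s by simp
  with is_lattice_conorm_lattice[OF sq] show ?thesis by blast
qed

text \<open>The vector \<open>vector [- sin t, cos t]\<close> is the unit normal of the mirror
  line.\<close>

lemma plane_reflection_inner:
  "plane_reflection t u = u - (2 * (u \<bullet> vector [- sin t, cos t])) *\<^sub>R vector [- sin t, cos t]"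
proof -
  have "cos (2 * t) = 1 - 2 * sin t * sin t" "cos (2 * t) = 2 * cos t * cos t - 1"
    using cos_double_sin[of t] cos_double_cos[of t] by (simp_all add: power2_eq_square)
  then show ?thesis
    unfolding vec2_eq_iff plane_reflection_lin2 inner_vec2 by (simp add: sin_double, algebra)
qed

lemma exists_plane_reflection:
  fixes n :: "real^2"
  assumes "n \<noteq> 0"
  shows "\<exists>t. \<forall>u. plane_reflection t u = u - (2 * (u \<bullet> n) / (n \<bullet> n)) *\<^sub>R n"
proof -
  let ?l = "norm n"
  have "(n$2 / ?l) ^ 2 + (- n$1 / ?l) ^ 2 = (n \<bullet> n) / ?l ^ 2"
    by (simp add: inner_vec2 power_divide power2_eq_square add_divide_distrib)
  also have "\<dots> = 1" using assms by (simp add: power2_norm_eq_inner)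
  finally obtain t where "n$2 / ?l = cos t" "- n$1 / ?l = sin t" using sincos_total_2pi by metis
  then have t: "vector [- sin t, cos t] = (1 / ?l) *\<^sub>R n" by (simp add: vec2_eq_iff flip: \<open>n$2 / ?l = cos t\<close> \<open>- n$1 / ?l = sin t\<close>)
  have "n \<bullet> n = ?l * ?l" by (simp add: power2_norm_eq_inner[symmetric] power2_eq_square)
  then have "plane_reflection t u = u - (2 * (u \<bullet> n) / (n \<bullet> n)) *\<^sub>R n" for u
    unfolding plane_reflection_inner t by simp
  then show ?thesis by blast
qed

text \<open>For orthogonal vectors the mirror normal to \<open>w\<close> fixes \<open>v\<close> and
  negates \<open>w\<close>; for equally long ones the mirror normal to \<open>v - w\<close>
  exchanges them.\<close>

lemma basis_reflection:
  assumes b: "lattice_basis \<Lambda> v w" and vw: "v \<bullet> w = 0 \<or> norm v = norm w"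
  shows "\<exists>t. plane_reflection t \<in> point_group \<Lambda>"
proof -
  have d: "det2 v w \<noteq> 0" using b by (simp add: lattice_basis_iff)
  have mem: "v \<in> \<Lambda>" "w \<in> \<Lambda>" "- w \<in> \<Lambda>"
    using lattice_basis_vectors[OF b] lattice_uminus[OF lattice_basis_lattice[OF b]] by auto
  have "\<exists>t. plane_reflection t v \<in> \<Lambda> \<and> plane_reflection t w \<in> \<Lambda>"
    using vw
  proof
    assume o: "v \<bullet> w = 0"
    have w: "w \<noteq> 0" using d by (auto simp: det2_def)
    then obtain t where "\<And>u. plane_reflection t u = u - (2 * (u \<bullet> w) / (w \<bullet> w)) *\<^sub>R w"
      using exists_plane_reflection by blast
    then have "plane_reflection t v = v" "plane_reflection t w = - w" using o w by (simp_all add: scaleR_2)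
    then show ?thesis using mem by metis
  next
    assume "norm v = norm w"
    then have n: "v \<bullet> v = w \<bullet> w" by (simp add: norm_eq)
    have "v - w \<noteq> 0" using d by (auto simp: det2_def)
    then obtain t where t: "\<And>u. plane_reflection t u = u - (2 * (u \<bullet> (v - w)) / ((v - w) \<bullet> (v - w))) *\<^sub>R (v - w)"
      using exists_plane_reflection by blast
    have "2 * (v \<bullet> (v - w)) = (v - w) \<bullet> (v - w)" "2 * (w \<bullet> (v - w)) = - ((v - w) \<bullet> (v - w))"
      using n by (simp_all add: inner_diff_left inner_diff_right inner_commute)
    moreover have "(v - w) \<bullet> (v - w) \<noteq> 0" using \<open>v - w \<noteq> 0\<close> by simp
    ultimately have "plane_reflection t v = w" "plane_reflection t w = v" unfolding t by simp_all
    then show ?thesis using mem by metis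
  qed
  then obtain t where t: "plane_reflection t v \<in> \<Lambda>" "plane_reflection t w \<in> \<Lambda>" by blast
  have "plane_reflection t ` \<Lambda> \<subseteq> \<Lambda>"
    using lattice_image_subset[OF b _ t] by (simp add: plane_reflection_lin2 linear_lin2)
  then have "plane_reflection t \<in> point_group \<Lambda>"
    using point_groupI[OF orthogonal_transformation_plane(2)] plane_reflection_involution by blast
  then show ?thesis by blast
qed

text \<open>A converse to \<open>reflection_PI\<close>: on each side of the triangle some two
  vectors of the superbase are orthogonal or equally long.\<close>

lemma boundary_reflection:
  assumes L: "is_lattice \<Lambda>" and xy: "PI \<Lambda> = (x, y)" "x = 0 \<or> y = 0 \<or> x + y = 1"
  shows "\<exists>t. plane_reflection t \<in> point_group \<Lambda>"
proof -
  from L obtain v0 v1 v2 a b c where v: "obtuse_superbase \<Lambda> v0 v1 v2"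
    and p: "- (v1 \<bullet> v2) = a ^ 2" "- (v0 \<bullet> v1) = b ^ 2" "- (v0 \<bullet> v2) = c ^ 2"
    and *: "0 \<le> a" "a \<le> b" "b \<le> c" "0 < b"
    and P: "PI \<Lambda> = ((c - b) / (a + b + c), 3 * a / (a + b + c))"
    by (rule PI_obtain)
  have v0: "v0 = - v1 - v2" using v by (simp add: obtuse_superbase_def superbase_def)
  have s: "0 < a + b + c" using * by linarith
  have "x = (c - b) / (a + b + c)" "y = 3 * a / (a + b + c)" using P xy(1) by simp_all
  then have "c - b = 0 \<or> 3 * a = 0 \<or> c - b + 3 * a = a + b + c"
    using xy(2) s by (auto simp: add_divide_distrib[symmetric])
  then consider "a = 0" | "a = b" | "b = c" by linarith
  then show ?thesis
  proof cases
    case 1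
    then show ?thesis using basis_reflection v p unfolding obtuse_superbase_iff by fastforce
  next
    case 2
    then have "norm v2 ^ 2 = norm v0 ^ 2" unfolding norm_sq_superbase[OF v0] p by simp
    then have "norm v2 = norm v0" by simp
    then show ?thesis using basis_reflection obtuse_superbase_rotate[OF v] unfolding obtuse_superbase_iff by blast
  next
    case 3
    then have "norm v1 ^ 2 = norm v2 ^ 2" unfolding norm_sq_superbase[OF v0] p by simp
    then have "norm v1 = norm v2" by simp
    then show ?thesis using basis_reflection v unfolding obtuse_superbase_iff by blast
  qed
qed

lemma boundary_D2:
  assumes L: "is_lattice \<Lambda>" and xy: "PI \<Lambda> = (x, y)" "x = 0 \<or> y = 0 \<or> x + y = 1"
    and "(x, y) \<noteq> (0, 0)" "(x, y) \<noteq> (0, 1)"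
  shows "has_point_group_D 2 \<Lambda>"
  using boundary_reflection[OF assms(1-3)] has_point_group_D2[OF L] assms by metis

text \<open>Square and hexagonal lattices are limits of the rhombic lattices with root products
  \<open>sqrt s, 1, 1\<close>.\<close>

lemma conorm_lattice_LIS_2:
  assumes s: "0 \<le> s" "s \<le> 1"
  shows "conorm_lattice s 1 1 \<in> LIS 2"
proof -
  \<comment> \<open>A convex combination of \<open>s\<close> and \<open>1 / 2\<close>, strictly
    between 0 and 1 even when \<open>s\<close> is an endpoint.\<close>
  define z where "z n = s + (1 / 2 - s) * (1 / real (n + 2))" for n
  have z: "0 < z n" "z n < 1" for n
  proof -
    define t where "t = 1 / real (n + 2)"
    have t: "0 < t" "t < 1" by (simp_all add: t_def)
    have zt: "z n = (1 - t) * s + t / 2" unfolding z_def t_def[symmetric] by (simp add: algebra_simps)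
    have "0 \<le> (1 - t) * s" "(1 - t) * s \<le> 1 - t"
      using s t by (simp_all add: mult_left_le)
    then show "0 < z n" "z n < 1" using t unfolding zt by linarith+
  qed
  have "(\<lambda>n. 1 / real (n + 2)) \<longlonglongrightarrow> 0"
    using LIMSEQ_ignore_initial_segment[OF lim_1_over_n, of 2] by simp
  then have "(\<lambda>n. s + (1 / 2 - s) * (1 / real (n + 2))) \<longlonglongrightarrow> s + (1 / 2 - s) * 0"
    by (intro tendsto_intros)
  then have lim: "z \<longlonglongrightarrow> s" by (simp add: z_def[abs_def])
  let ?S = "{(v', w'). \<exists>\<Lambda>'. lattice_basis \<Lambda>' v' w' \<and> has_point_group_D 2 \<Lambda>'}"
  let ?x = "\<lambda>s. (conorm_vec1 s 1 1, conorm_vec2 s 1 1)"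
  have mem: "\<forall>n. ?x (z n) \<in> ?S"
  proof
    fix n
    have zn: "0 \<le> z n" "z n \<le> 1" "(1::real) \<le> 1" "(0::real) < 1" using z[of n] by auto
    define r where "r = sqrt (z n)"
    have r: "0 < r" "r < 1" using z[of n] by (simp_all add: r_def)
    \<comment> \<open>For \<open>0 < r < 1\<close> this point lies on the side \<open>x = 0\<close>
      strictly between its two vertices.\<close>
    have "PI (conorm_lattice (z n) 1 1) = (0, 3 * r / (r + 2))"
      unfolding conorm_lattice_PI[OF zn] by (simp add: r_def)
    then have "has_point_group_D 2 (conorm_lattice (z n) 1 1)"
      by (rule boundary_D2[OF is_lattice_conorm_lattice[OF zn]]) (use r in auto)
    then show "?x (z n) \<in> ?S" using conorm_lattice_superbase(1)[OF zn] by blast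
  qed
  have x_lim: "(\<lambda>n. ?x (z n)) \<longlonglongrightarrow> ?x s"
  proof -
    have v: "vector [a, b] = (\<chi> i. if i = (1::2) then a else b)" for a b :: real
      by (simp add: vec2_eq_iff)
    have "(\<lambda>n. \<chi> i. if i = (1::2) then f n else g n) \<longlonglongrightarrow> (\<chi> i. if i = 1 then a else b)"
      if "f \<longlonglongrightarrow> (a::real)" "g \<longlonglongrightarrow> b" for f g a b
      by (rule tendsto_vec_lambda) (use that in auto)
    then show ?thesis unfolding conorm_vec1_def conorm_vec2_def v
      by (intro tendsto_Pair) (use s in \<open>auto intro!: tendsto_intros lim\<close>)
  qed
  have "?x s \<in> closure ?S"
    unfolding closure_sequential by (rule exI[of _ "\<lambda>n. ?x (z n)"]) (use mem x_lim in simp)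
  then show ?thesis unfolding LIS_def using conorm_lattice_superbase(1)[OF s] by fastforce
qed

lemma exists_LIS_2_with_PI:
  assumes "0 \<le> x" "x < 1" "0 \<le> y" "x + y \<le> 1" "x = 0 \<or> y = 0 \<or> x + y = 1"
  shows "\<exists>\<Lambda> \<in> LIS 2. PI \<Lambda> = (x, y)"
proof (cases "(x, y) = (0, 0) \<or> (x, y) = (0, 1)")
  case True
  then show ?thesis
    using conorm_lattice_LIS_2[of 0] conorm_lattice_LIS_2[of 1] conorm_lattice_PI[of 0 1 1] conorm_lattice_PI[of 1 1 1]
    by auto
next
  case False
  obtain \<Lambda> where L: "is_lattice \<Lambda>" "PI \<Lambda> = (x, y)" using exists_lattice_with_PI assms by blast
  then have "has_point_group_D 2 \<Lambda>" using boundary_D2[OF L] assms False by blast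
  then show ?thesis using LISI L unfolding is_lattice_def by blast
qed

text \<open>For \<open>p = 0\<close> the basis spans a unit square. For \<open>p = 1\<close> its
  vectors enclose 120 degrees, so a sixth turn maps \<open>v\<close> to \<open>v + w\<close> and
  \<open>w\<close> to \<open>- v\<close>.\<close>

lemma conorm_lattice_turn:
  assumes "p = 0 \<and> t = pi / 2 \<or> p = 1 \<and> t = pi / 3"
  shows "plane_rotation t \<in> point_group (conorm_lattice p 1 1)"
proof -
  have pq: "0 \<le> p" "p \<le> 1" "(1::real) \<le> 1" "(0::real) < 1" using assms by auto
  let ?v = "conorm_vec1 p 1 1" and ?w = "conorm_vec2 p 1 1" and ?L = "conorm_lattice p 1 1"
  note b = conorm_lattice_superbase(1)[OF pq]
  have L: "is_lattice ?L" by (rule is_lattice_conorm_lattice[OF pq])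
  have mem: "?v \<in> ?L" "?w \<in> ?L" "- ?v \<in> ?L" "- ?w \<in> ?L" "?v + ?w \<in> ?L"
    using lattice_basis_vectors[OF b] lattice_uminus[OF L] lattice_add[OF L] by auto
  have r: "plane_rotation t ?v = ?w \<and> plane_rotation t ?w = - ?v \<and>
      plane_rotation (- t) ?v = - ?w \<and> plane_rotation (- t) ?w = ?v" if "p = 0" "t = pi / 2"
    unfolding that by (simp add: plane_rotation_lin2 vec2_eq_iff conorm_vec1_def conorm_vec2_def)
  have 3: "sqrt (3 / 2) = sqrt 2 * (sqrt 3 / 2)" "1 / sqrt 2 = sqrt 2 / 2"
    by (simp_all add: real_sqrt_divide field_simps)
  have r': "plane_rotation t ?v = ?v + ?w \<and> plane_rotation t ?w = - ?v \<and>
      plane_rotation (- t) ?v = - ?w \<and> plane_rotation (- t) ?w = ?v + ?w" if "p = 1" "t = pi / 3"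
    unfolding that by (simp add: plane_rotation_lin2 vec2_eq_iff conorm_vec1_def conorm_vec2_def cos_60 sin_60 3 algebra_simps)
  have im: "plane_rotation t ?v \<in> ?L" "plane_rotation t ?w \<in> ?L" "plane_rotation (- t) ?v \<in> ?L" "plane_rotation (- t) ?w \<in> ?L"
    using assms r r' mem by metis+
  have lin: "linear (plane_rotation t)" for t by (simp add: plane_rotation_lin2 linear_lin2)
  show ?thesis
  proof (rule point_groupI[OF orthogonal_transformation_plane(1)])
    show "plane_rotation t ` ?L \<subseteq> ?L" "plane_rotation (- t) ` ?L \<subseteq> ?L"
      by (rule lattice_image_subset[OF b lin]; fact im)+
    show "plane_rotation t (plane_rotation (- t) u) = u" for u
      using fun_cong[OF plane_rotation_add[of t "- t"], of u] by (simp add: plane_rotation_0)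
  qed
qed

lemma conorm_lattice_LIS_4: "conorm_lattice 0 1 1 \<in> LIS 4"
proof -
  have pq: "(0::real) \<le> 0" "(0::real) \<le> 1" "(1::real) \<le> 1" "(0::real) < 1" by auto
  have P: "PI (conorm_lattice 0 1 1) = (0, 0)" using conorm_lattice_PI[OF pq] by simp
  obtain t where "plane_reflection t \<in> point_group (conorm_lattice 0 1 1)"
    using boundary_reflection[OF is_lattice_conorm_lattice[OF pq] P] by blast
  then show ?thesis
    using LISI[OF conorm_lattice_superbase(1)[OF pq]] conorm_lattice_turn[of 0 "pi / 2"]
      has_point_group_D4[OF is_lattice_conorm_lattice[OF pq] _ P] by blast
qed

lemma conorm_lattice_LIS_6: "conorm_lattice 1 1 1 \<in> LIS 6"
proof -
  have pq: "(0::real) \<le> 1" "(1::real) \<le> 1" "(1::real) \<le> 1" "(0::real) < 1" by auto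
  have P: "PI (conorm_lattice 1 1 1) = (0, 1)" using conorm_lattice_PI[OF pq] by simp
  obtain t where "plane_reflection t \<in> point_group (conorm_lattice 1 1 1)"
    using boundary_reflection[OF is_lattice_conorm_lattice[OF pq] P] by blast
  then show ?thesis
    using LISI[OF conorm_lattice_superbase(1)[OF pq]] conorm_lattice_turn[of 1 "pi / 3"]
      has_point_group_D6[OF is_lattice_conorm_lattice[OF pq] _ P] by blast
qed

section \<open>Projected chiral distances\<close>

lemma PC_eqI:
  assumes "\<Lambda>' \<in> LIS n" "minkowski_norm q (PI \<Lambda> - PI \<Lambda>') = d"
    and "\<And>\<Lambda>''. \<Lambda>'' \<in> LIS n \<Longrightarrow> d \<le> minkowski_norm q (PI \<Lambda> - PI \<Lambda>'')"
  shows "PC q n \<Lambda> = d"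
  unfolding PC_def by (rule Least_equality) (use assms in auto)

text \<open>\<open>PI\<close> is constant on \<open>LIS 4\<close>, so any member attains the
  minimum.\<close>

lemma PC_4_eq: "PC q 4 \<Lambda> = minkowski_norm q (PI \<Lambda>)"
  by (rule PC_eqI[OF conorm_lattice_LIS_4]) (simp_all add: LIS_4_PI conorm_lattice_LIS_4 zero_prod_def[symmetric])

lemma PC_6_eq: "PC q 6 \<Lambda> = minkowski_norm q (PI \<Lambda> - (0, 1))"
  by (rule PC_eqI[OF conorm_lattice_LIS_6]) (simp_all add: LIS_6_PI conorm_lattice_LIS_6)

lemma minkowski_norm_ereal:
  "minkowski_norm (ereal q) (x, y) = (\<bar>x\<bar> powr q + \<bar>y\<bar> powr q) powr (1 / q)"
  by (simp add: minkowski_norm_def)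

lemma minkowski_norm_infinity: "minkowski_norm \<infinity> (x, y) = max \<bar>x\<bar> \<bar>y\<bar>"
  by (simp add: minkowski_norm_def)

lemma minkowski_norm_2: "minkowski_norm 2 (x, y) = sqrt (x ^ 2 + y ^ 2)"
  using minkowski_norm_ereal[of 2 x y] by (simp add: powr_half_sqrt)

text \<open>A common frame for both norms. The bounds \<open>low\<close> estimate the distance to
  each side from below; \<open>eq\<close> evaluates the norm at horizontal, vertical and diagonal
  displacements that reach them. The number \<open>k\<close> is the norm of the functional
  \<open>u + v\<close>.\<close>

lemma PC_2_eq:
  assumes L: "is_lattice \<Lambda>" "PI \<Lambda> = (x, y)"
    and low: "\<And>u v. \<bar>u\<bar> \<le> minkowski_norm q (u, v)" "\<And>u v. \<bar>v\<bar> \<le> minkowski_norm q (u, v)"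
      "\<And>u v. \<bar>u + v\<bar> / k \<le> minkowski_norm q (u, v)"
    and eq: "minkowski_norm q (x, 0) = x" "minkowski_norm q (0, y) = y"
      "minkowski_norm q (- (1 - x - y) / 2, - (1 - x - y) / 2) = (1 - x - y) / k"
  shows "PC q 2 \<Lambda> = Min {x, y, (1 - x - y) / k}"
proof -
  note bounds = PI_bounds[OF L]
  let ?m = "Min {x, y, (1 - x - y) / k}"
  have "\<exists>\<Lambda>'\<in>LIS 2. minkowski_norm q (PI \<Lambda> - PI \<Lambda>') = ?m"
  proof -
    have "?m \<in> {x, y, (1 - x - y) / k}" by (rule Min_in) auto
    then consider "?m = x" | "?m = y" | "?m = (1 - x - y) / k" by blast
    then show ?thesis
    proof cases
      case 1
      obtain \<Lambda>' where "\<Lambda>' \<in> LIS 2" "PI \<Lambda>' = (0, y)" using exists_LIS_2_with_PI[of 0 y] bounds by auto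
      then show ?thesis using 1 L eq by (intro bexI[of _ \<Lambda>']) simp_all
    next
      case 2
      obtain \<Lambda>' where "\<Lambda>' \<in> LIS 2" "PI \<Lambda>' = (x, 0)" using exists_LIS_2_with_PI[of x 0] bounds by auto
      then show ?thesis using 2 L eq by (intro bexI[of _ \<Lambda>']) simp_all
    next
      case 3
      \<comment> \<open>The diagonal foot point has first coordinate \<open>(1 + x - y) / 2\<close>,
        which is below 1 since \<open>x < 1\<close> and \<open>0 \<le> y\<close>; so it is not the
        missing vertex.\<close>
      have "x + (1 - x - y) / 2 < 1" using bounds by (simp add: field_simps)
      moreover have "x + (1 - x - y) / 2 + (y + (1 - x - y) / 2) = 1" by (simp add: field_simps)
      ultimately obtain \<Lambda>' where "\<Lambda>' \<in> LIS 2" "PI \<Lambda>' = (x + (1 - x - y) / 2, y + (1 - x - y) / 2)"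
        using exists_LIS_2_with_PI[of "x + (1 - x - y) / 2" "y + (1 - x - y) / 2"] bounds by auto
      moreover from this have "PI \<Lambda> - PI \<Lambda>' = (- (1 - x - y) / 2, - (1 - x - y) / 2)" using L by (simp add: field_simps)
      ultimately show ?thesis using 3 eq by metis
    qed
  qed
  then obtain \<Lambda>' where L': "\<Lambda>' \<in> LIS 2" "minkowski_norm q (PI \<Lambda> - PI \<Lambda>') = ?m" by blast
  show ?thesis
  proof (rule PC_eqI[OF L'])
    fix \<Lambda>'' assume M: "\<Lambda>'' \<in> LIS 2"
    obtain a b where ab: "PI \<Lambda>'' = (a, b)" by fastforce
    have diff: "PI \<Lambda> - PI \<Lambda>'' = (x - a, y - b)" using L ab by simp
    have m: "?m \<le> x" "?m \<le> y" "?m \<le> (1 - x - y) / k" by simp_all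
    from LIS_2_PI[OF M ab] show "?m \<le> minkowski_norm q (PI \<Lambda> - PI \<Lambda>'')"
    proof (elim disjE)
      assume "a = 0"
      then have "x \<le> minkowski_norm q (x - a, y - b)" using low(1)[of "x - a" "y - b"] bounds by simp
      then show ?thesis unfolding diff by (rule order_trans[OF m(1)])
    next
      assume "b = 0"
      then have "y \<le> minkowski_norm q (x - a, y - b)" using low(2)[of "y - b" "x - a"] bounds by simp
      then show ?thesis unfolding diff by (rule order_trans[OF m(2)])
    next
      assume "a + b = 1"
      then have "\<bar>(x - a) + (y - b)\<bar> = 1 - x - y" using bounds by linarith
      then show ?thesis using low(3)[of "x - a" "y - b"] m(3) unfolding diff by simp
    qed
  qed
qed

lemma PC_2_2_eq:
  assumes "is_lattice \<Lambda>" "PI \<Lambda> = (x, y)"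
  shows "PC 2 2 \<Lambda> = Min {x, y, (1 - x - y) / sqrt 2}"
proof (rule PC_2_eq[OF assms]; unfold minkowski_norm_2)
  note b = PI_bounds[OF assms]
  fix u v :: real
  show "\<bar>u\<bar> \<le> sqrt (u ^ 2 + v ^ 2)" "\<bar>v\<bar> \<le> sqrt (u ^ 2 + v ^ 2)" by (simp_all add: real_le_rsqrt)
  \<comment> \<open>The difference \<open>2 * (u ^ 2 + v ^ 2) - (u + v) ^ 2\<close> is
    \<open>(u - v) ^ 2\<close>.\<close>
  have "\<bar>u + v\<bar> \<le> sqrt 2 * sqrt (u ^ 2 + v ^ 2)"
    unfolding real_sqrt_mult[symmetric]
    by (rule real_le_rsqrt) (use sum_squares_ge_zero[of "u - v" 0] in \<open>simp add: power2_eq_square algebra_simps\<close>)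
  then show "\<bar>u + v\<bar> / sqrt 2 \<le> sqrt (u ^ 2 + v ^ 2)" by (simp add: divide_le_eq mult.commute)
  show "sqrt (x ^ 2 + 0 ^ 2) = x" "sqrt (0 ^ 2 + y ^ 2) = y" using b by simp_all
  let ?t = "1 - x - y"
  have sq: "(- ?t / 2) ^ 2 + (- ?t / 2) ^ 2 = ?t ^ 2 / 2" by (simp only: power_divide power2_minus) simp
  show "sqrt ((- ?t / 2) ^ 2 + (- ?t / 2) ^ 2) = ?t / sqrt 2"
    unfolding sq using b by (simp add: real_sqrt_divide)
qed

lemma PC_infinity_2_eq:
  assumes "is_lattice \<Lambda>" "PI \<Lambda> = (x, y)"
  shows "PC \<infinity> 2 \<Lambda> = Min {x, y, (1 - x - y) / 2}"
  by (rule PC_2_eq[OF assms]; unfold minkowski_norm_infinity)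
    (use PI_bounds[OF assms] in \<open>auto simp: max_def abs_if field_simps\<close>)

text \<open>The defining basis has an acute angle; negating \<open>w\<close> gives the superbase
  \<open>w - v\<close>, \<open>v\<close>, \<open>- w\<close>, whose three products all equal
  \<open>v \<bullet> w\<close>.\<close>

lemma hexagonal_lattice_PI:
  assumes "hexagonal_lattice \<Lambda>"
  shows "is_lattice \<Lambda>" "PI \<Lambda> = (0, 1)"
proof -
  obtain v w where b: "lattice_basis \<Lambda> v w" and n: "norm v = norm w"
    and i: "v \<bullet> w = norm v * norm w * cos (pi / 3)"
    using assms unfolding hexagonal_lattice_def by blast
  show "is_lattice \<Lambda>" using b by (rule lattice_basis_lattice)
  define e where "e = v \<bullet> w"
  have vw: "v \<bullet> v = 2 * e" "w \<bullet> w = 2 * e" "v \<bullet> w = e" "w \<bullet> v = e"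
    using i n by (simp_all add: e_def cos_60 inner_commute power2_norm_eq_inner[symmetric] power2_eq_square)
  have "v \<noteq> 0" using b by (auto simp: lattice_basis_iff det2_def)
  then have "0 < v \<bullet> v" by simp
  with vw(1) have e: "0 < e" by simp
  have "lattice_basis \<Lambda> v (- w)"
    using lattice_basis_swap[OF lattice_basis_uminus[OF lattice_basis_swap[OF b]]] .
  then have "obtuse_superbase \<Lambda> (w - v) v (- w)"
    using e by (simp add: obtuse_superbase_iff inner_diff_left vw)
  from PI_eq[OF this _ _ refl] show "PI \<Lambda> = (0, 1)"
    using e by (simp add: inner_diff_left vw)
qed

text \<open>An orthogonal basis with \<open>- v - w\<close> is an obtuse superbase with products 0
  and the two squared lengths; only the order of the vectors has to be arranged.\<close>

lemma rectangular_lattice_PI: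
  assumes "rectangular_lattice \<Lambda>"
  shows "is_lattice \<Lambda>" "snd (PI \<Lambda>) = 0"
proof -
  obtain v w where b: "lattice_basis \<Lambda> v w" and o: "v \<bullet> w = 0"
    using assms unfolding rectangular_lattice_def by blast
  show "is_lattice \<Lambda>" using b by (rule lattice_basis_lattice)
  have *: "snd (PI \<Lambda>) = 0" if "lattice_basis \<Lambda> v w" "v \<bullet> w = 0" "v \<bullet> v \<le> w \<bullet> w" for v w
  proof -
    have "obtuse_superbase \<Lambda> (- v - w) v w"
      using that by (simp add: obtuse_superbase_iff inner_diff_left inner_commute[of w v])
    from PI_eq[OF this _ _ refl] show ?thesis
      using that by (simp add: inner_diff_left inner_commute[of w v])
  qed
  show "snd (PI \<Lambda>) = 0"
    using *[OF b] *[OF lattice_basis_swap[OF b]] o by (cases "v \<bullet> v \<le> w \<bullet> w") (simp_all add: inner_commute)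
qed

lemma square_lattice_rectangular: "square_lattice \<Lambda> \<Longrightarrow> rectangular_lattice \<Lambda>"
  unfolding square_lattice_def rectangular_lattice_def by blast

lemma exists_square_lattice: "\<exists>\<Lambda>. square_lattice \<Lambda>"
proof -
  let ?v = "vector [1, 0] :: real^2" and ?w = "vector [0, 1] :: real^2"
  have "lattice_basis (generated_lattice ?v ?w) ?v ?w"
    by (rule lattice_basis_generated) (simp add: det2_def)
  moreover have "?v \<bullet> ?w = 0" "norm ?v = norm ?w" by (simp_all add: inner_vec2 norm_eq_sqrt_inner)
  ultimately show ?thesis unfolding square_lattice_def by blast
qed

lemma exists_hexagonal_lattice: "\<exists>\<Lambda>. hexagonal_lattice \<Lambda>"
proof -
  let ?v = "vector [1, 0] :: real^2" and ?w = "vector [1 / 2, sqrt 3 / 2] :: real^2"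
  have "lattice_basis (generated_lattice ?v ?w) ?v ?w"
    by (rule lattice_basis_generated) (simp add: det2_def)
  moreover have n: "norm ?v = 1" "norm ?w = 1" by (simp_all add: inner_vec2 norm_eq_sqrt_inner)
  moreover have "?v \<bullet> ?w = 1 / 2" by (simp add: inner_vec2)
  ultimately show ?thesis unfolding hexagonal_lattice_def
    by (intro exI[of _ "generated_lattice ?v ?w"] exI[of _ ?v] exI[of _ ?w]) (simp add: cos_60)
qed

section \<open>Formulas and bounds for square and hexagonal symmetry\<close>

lemma PC_ereal_4:
  assumes "is_lattice \<Lambda>" "PI \<Lambda> = (x, y)"
  shows "PC (ereal q) 4 \<Lambda> = (x powr q + y powr q) powr (1 / q)"
  using PI_bounds[OF assms] unfolding PC_4_eq assms(2) minkowski_norm_ereal by simp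

lemma PC_ereal_6:
  assumes "is_lattice \<Lambda>" "PI \<Lambda> = (x, y)"
  shows "PC (ereal q) 6 \<Lambda> = (x powr q + (1 - y) powr q) powr (1 / q)"
proof -
  have "\<bar>y - 1\<bar> = 1 - y" using PI_bounds[OF assms] by simp
  then show ?thesis
    using PI_bounds[OF assms] unfolding PC_6_eq assms(2) by (simp add: minkowski_norm_ereal)
qed

text \<open>The value is the maximum and not \<open>x\<close> alone: a hexagonal lattice has
  \<open>PI = (0, 1)\<close> and distance 1.\<close>

lemma PC_infinity_4:
  assumes "is_lattice \<Lambda>" "PI \<Lambda> = (x, y)"
  shows "PC \<infinity> 4 \<Lambda> = max x y"
  using PI_bounds[OF assms] unfolding PC_4_eq assms(2) by (simp add: minkowski_norm_infinity)

lemma PC_infinity_6: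
  assumes "is_lattice \<Lambda>" "PI \<Lambda> = (x, y)"
  shows "PC \<infinity> 6 \<Lambda> = 1 - y"
  using PI_bounds[OF assms] unfolding PC_6_eq assms(2) by (simp add: minkowski_norm_infinity abs_if)

lemma PC_4_le_1:
  fixes q :: ereal
  assumes L: "is_lattice \<Lambda>" and q: "1 \<le> q"
  shows "PC q 4 \<Lambda> \<le> 1"
proof -
  obtain x y where xy: "PI \<Lambda> = (x, y)" by fastforce
  note b = PI_bounds[OF L xy]
  show ?thesis
  proof (cases q)
    case (real r)
    then have r: "1 \<le> r" using q by (simp add: one_ereal_def)
    \<comment> \<open>Powers with exponent at least 1 do not increase numbers in the unit interval,
      so the sum is at most \<open>x + y\<close>.\<close>
    have p: "z powr r \<le> z" if "0 \<le> z" "z \<le> 1" for z :: real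
      using powr_mono'[OF r that] that by simp
    have "x powr r + y powr r \<le> 1" using p[of x] p[of y] b by linarith
    then have "(x powr r + y powr r) powr (1 / r) \<le> 1 powr (1 / r)"
      using r by (intro powr_mono2) auto
    then show ?thesis unfolding real PC_ereal_4[OF L xy] by simp
  next
    case PInf
    then show ?thesis using PC_infinity_4[OF L xy] b by simp
  next
    case MInf
    then show ?thesis using q by simp
  qed
qed

lemma PC_4_hexagonal:
  fixes q :: ereal
  assumes L: "hexagonal_lattice \<Lambda>" and q: "1 \<le> q"
  shows "PC q 4 \<Lambda> = 1"
proof (cases q)
  case (real r)
  then show ?thesis using PC_ereal_4[OF hexagonal_lattice_PI[OF L]] by simp
next
  case PInf
  then show ?thesis using PC_infinity_4[OF hexagonal_lattice_PI[OF L]] by simp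
next
  case MInf
  then show ?thesis using q by simp
qed

text \<open>Strictness comes from \<open>x < 1\<close>; the bound itself would be the value at the
  missing vertex \<open>(1, 0)\<close>.\<close>

lemma PC_6_less:
  fixes q :: real
  assumes L: "is_lattice \<Lambda>" and q: "1 \<le> q"
  shows "PC (ereal q) 6 \<Lambda> < 2 powr (1 / q)"
proof -
  obtain x y where xy: "PI \<Lambda> = (x, y)" by fastforce
  note b = PI_bounds[OF L xy]
  have "x powr q < 1 powr q" using b q by (intro powr_less_mono2) auto
  moreover have "(1 - y) powr q \<le> 1 powr q" using b q by (intro powr_mono2) auto
  ultimately have "x powr q + (1 - y) powr q < 2" by simp
  then show ?thesis unfolding PC_ereal_6[OF L xy] using q by (intro powr_less_mono2) auto
qed

text \<open>The filter \<open>F\<close> expresses that the first coordinate of \<open>PI\<close>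
  tends to 1 from below within the lattices. It is proper because the points \<open>(x, 0)\<close>
  with \<open>x\<close> close to 1 are attained.\<close>

lemma PC_6_limit:
  fixes q :: real
  assumes q: "1 \<le> q"
  defines "F \<equiv> inf (filtercomap (\<lambda>\<Lambda>. fst (PI \<Lambda>)) (at_left 1)) (principal {\<Lambda>. is_lattice \<Lambda>})"
  shows "F \<noteq> bot" "((\<lambda>\<Lambda>. PC (ereal q) 6 \<Lambda>) \<longlongrightarrow> 2 powr (1 / q)) F"
proof -
  show "F \<noteq> bot"
  proof
    assume "F = bot"
    then have "eventually (\<lambda>_. False) F" by simp
    then obtain Q where "eventually Q (at_left (1::real))" and Q: "\<And>\<Lambda>. Q (fst (PI \<Lambda>)) \<Longrightarrow> \<not> is_lattice \<Lambda>"
      unfolding F_def eventually_inf_principal eventually_filtercomap by auto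
    then obtain b where b: "b < 1" "\<And>x. b < x \<Longrightarrow> x < 1 \<Longrightarrow> Q x"
      using eventually_at_left[of 0 1 Q] by auto
    \<comment> \<open>The maximum with 0 handles a negative \<open>b\<close>, for which the midpoint
      may lie outside the triangle.\<close>
    let ?x = "max 0 ((b + 1) / 2)"
    have "b < (b + 1) / 2" using b(1) by simp
    then have x: "0 \<le> ?x" "?x < 1" "b < ?x" using b(1) by (simp_all add: less_max_iff_disj)
    then obtain \<Lambda> where "is_lattice \<Lambda>" "PI \<Lambda> = (?x, 0)" using exists_lattice_with_PI[of ?x 0] by auto
    with Q[of \<Lambda>] b(2)[OF x(3,2)] show False by simp
  qed
  have lat: "eventually is_lattice F"
    unfolding F_def eventually_inf_principal by simp
  have "filterlim (\<lambda>\<Lambda>. fst (PI \<Lambda>)) (at_left 1) F"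
    unfolding F_def by (rule filterlim_mono[OF filterlim_filtercomap]) auto
  then have fst: "((\<lambda>\<Lambda>. fst (PI \<Lambda>)) \<longlongrightarrow> 1) F"
    by (rule filterlim_mono) (auto simp: at_within_le_nhds)
  have "((\<lambda>\<Lambda>. 1 - fst (PI \<Lambda>)) \<longlongrightarrow> 1 - 1) F" by (intro tendsto_intros fst)
  then have upper: "((\<lambda>\<Lambda>. 1 - fst (PI \<Lambda>)) \<longlongrightarrow> 0) F" by simp
  have bounds: "eventually (\<lambda>\<Lambda>. 0 \<le> snd (PI \<Lambda>)) F" "eventually (\<lambda>\<Lambda>. snd (PI \<Lambda>) \<le> 1 - fst (PI \<Lambda>)) F"
    using lat
    by (auto elim!: eventually_mono dest: PI_bounds[OF _ surjective_pairing])
  \<comment> \<open>The second coordinate is squeezed between 0 and \<open>1 - x\<close>.\<close>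
  have snd: "((\<lambda>\<Lambda>. snd (PI \<Lambda>)) \<longlongrightarrow> 0) F"
    by (rule tendsto_sandwich[OF bounds tendsto_const upper])
  have "((\<lambda>\<Lambda>. (fst (PI \<Lambda>) powr q + (1 - snd (PI \<Lambda>)) powr q) powr (1 / q)) \<longlongrightarrow>
      (1 powr q + (1 - 0) powr q) powr (1 / q)) F"
    by (intro tendsto_intros fst snd) auto
  moreover have "eventually (\<lambda>\<Lambda>. PC (ereal q) 6 \<Lambda> =
      (fst (PI \<Lambda>) powr q + (1 - snd (PI \<Lambda>)) powr q) powr (1 / q)) F"
    using lat by (rule eventually_mono) (rule PC_ereal_6[OF _ surjective_pairing])
  ultimately show "((\<lambda>\<Lambda>. PC (ereal q) 6 \<Lambda>) \<longlongrightarrow> 2 powr (1 / q)) F"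
    by (simp add: tendsto_cong)
qed

text \<open>The bound is the inradius of the triangle: if all three distances exceeded
  \<open>c\<close>, then \<open>x + y + (1 - x - y)\<close> would exceed
  \<open>2 * c + c * sqrt 2 = 1\<close>.\<close>

lemma PC_2_2_bound:
  assumes L: "is_lattice \<Lambda>"
  shows "PC 2 2 \<Lambda> \<le> 1 / (2 + sqrt 2)"
proof -
  obtain x y where xy: "PI \<Lambda> = (x, y)" by fastforce
  define c where "c = 1 / (2 + sqrt 2)"
  have s: "0 < sqrt (2::real)" by simp
  then have "2 + sqrt (2::real) \<noteq> 0" by linarith
  then have "c * (2 + sqrt 2) = 1" unfolding c_def by simp
  then have c: "2 * c + c * sqrt 2 = 1" by (simp add: algebra_simps)
  have "x \<le> c \<or> y \<le> c \<or> (1 - x - y) / sqrt 2 \<le> c"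
  proof (rule ccontr)
    assume "\<not> ?thesis"
    then have "c < x" "c < y" "c * sqrt 2 < 1 - x - y" using s by (auto simp: not_le less_divide_eq)
    with c show False by linarith
  qed
  then show ?thesis unfolding PC_2_2_eq[OF L xy] c_def[symmetric] by (simp add: min_le_iff_disj)
qed

lemma PC_infinity_2_bound:
  assumes L: "is_lattice \<Lambda>"
  shows "PC \<infinity> 2 \<Lambda> \<le> 1 / 4"
proof -
  obtain x y where xy: "PI \<Lambda> = (x, y)" by fastforce
  \<comment> \<open>Adding the first two inequalities and twice the third gives
    \<open>4 * m \<le> 1\<close>.\<close>
  have bound: "m \<le> 1 / 4" if "m \<le> x" "m \<le> y" "m \<le> (1 - x - y) / 2" for m
    using that by argo
  show ?thesis unfolding PC_infinity_2_eq[OF L xy] by (rule bound; rule Min_le; simp)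
qed

lemma PC_2_2_extremal:
  assumes "is_lattice \<Lambda>" "PI \<Lambda> = (1 / (2 + sqrt 2), 1 / (2 + sqrt 2))"
  shows "PC 2 2 \<Lambda> = 1 / (2 + sqrt 2)"
proof -
  define c where "c = 1 / (2 + sqrt 2)"
  have s: "0 < sqrt (2::real)" by simp
  then have "2 + sqrt (2::real) \<noteq> 0" by linarith
  then have "c * (2 + sqrt 2) = 1" unfolding c_def by simp
  then have "1 - c - c = c * sqrt 2" by (simp add: algebra_simps)
  then show ?thesis using PC_2_2_eq[OF assms] unfolding c_def[symmetric] by simp
qed

text \<open>The existence clauses keep the attainment clauses from being vacuous, and properness of
  \<open>F\<close> does the same for the limit.\<close>

theorem proposition6p6:
  shows
   "(\<forall>\<Lambda> x y. is_lattice \<Lambda> \<and> PI \<Lambda> = (x, y) \<longrightarrow>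
       x \<in> {0..<1} \<and> y \<in> {0..1} \<and> x + y \<le> 1 \<and>
       \<comment> \<open>(a)\<close>
       PC 2 2 \<Lambda> = Min {x, y, (1 - x - y) / sqrt 2} \<and>
       (\<forall>q::real. q \<ge> 1 \<longrightarrow> PC (ereal q) 4 \<Lambda> = (x powr q + y powr q) powr (1 / q)) \<and>
       (\<forall>q::real. q \<ge> 1 \<longrightarrow> PC (ereal q) 6 \<Lambda> = (x powr q + (1 - y) powr q) powr (1 / q)) \<and>
       \<comment> \<open>(b)\<close>
       PC \<infinity> 2 \<Lambda> = Min {x, y, (1 - x - y) / 2} \<and>
       PC \<infinity> 4 \<Lambda> = max x y \<and>
       PC \<infinity> 6 \<Lambda> = 1 - y) \<and>
    \<comment> \<open>(c)\<close>
    (\<forall>\<Lambda>. is_lattice \<Lambda> \<longrightarrow> PC 2 2 \<Lambda> \<le> 1 / (2 + sqrt 2)) \<and>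
    (\<exists>\<Lambda>. is_lattice \<Lambda> \<and> PI \<Lambda> = (1 / (2 + sqrt 2), 1 / (2 + sqrt 2))) \<and>
    (\<forall>\<Lambda>. is_lattice \<Lambda> \<and> PI \<Lambda> = (1 / (2 + sqrt 2), 1 / (2 + sqrt 2)) \<longrightarrow>
       PC 2 2 \<Lambda> = 1 / (2 + sqrt 2)) \<and>
    (\<forall>\<Lambda>. is_lattice \<Lambda> \<longrightarrow> PC \<infinity> 2 \<Lambda> \<le> 1 / 4) \<and>
    (\<exists>\<Lambda>. is_lattice \<Lambda> \<and> PI \<Lambda> = (1 / 4, 1 / 4)) \<and>
    (\<forall>\<Lambda>. is_lattice \<Lambda> \<and> PI \<Lambda> = (1 / 4, 1 / 4) \<longrightarrow> PC \<infinity> 2 \<Lambda> = 1 / 4) \<and>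
    (\<forall>q::ereal. q \<ge> 1 \<longrightarrow>
       (\<forall>\<Lambda>. is_lattice \<Lambda> \<longrightarrow> PC q 4 \<Lambda> \<le> 1) \<and>
       (\<forall>\<Lambda>. hexagonal_lattice \<Lambda> \<longrightarrow> PC q 4 \<Lambda> = 1)) \<and>
    (\<forall>q::real. q \<ge> 1 \<longrightarrow>
       (\<forall>\<Lambda>. is_lattice \<Lambda> \<longrightarrow> PC (ereal q) 6 \<Lambda> < 2 powr (1 / q)) \<and>
       (let F = inf (filtercomap (\<lambda>\<Lambda>. fst (PI \<Lambda>)) (at_left 1)) (principal {\<Lambda>. is_lattice \<Lambda>})
        in F \<noteq> bot \<and> ((\<lambda>\<Lambda>. PC (ereal q) 6 \<Lambda>) \<longlongrightarrow> 2 powr (1 / q)) F)) \<and>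
    (\<forall>\<Lambda>. is_lattice \<Lambda> \<longrightarrow> PC \<infinity> 6 \<Lambda> \<le> 1) \<and>
    (\<forall>\<Lambda>. square_lattice \<Lambda> \<or> rectangular_lattice \<Lambda> \<longrightarrow> PC \<infinity> 6 \<Lambda> = 1) \<and>
    (\<exists>\<Lambda>. hexagonal_lattice \<Lambda>) \<and> (\<exists>\<Lambda>. square_lattice \<Lambda>) \<and> (\<exists>\<Lambda>. rectangular_lattice \<Lambda>)"
proof -
  have c: "1 / (2 + sqrt 2) \<ge> 0" "1 / (2 + sqrt 2) < (1::real)" "1 / (2 + sqrt 2) + 1 / (2 + sqrt 2) \<le> (1::real)"
  proof -
    have "0 < sqrt (2::real)" by simp
    then have "2 < 2 + sqrt (2::real)" "0 < 2 + sqrt (2::real)" "0 < 1 + sqrt (2::real)" by linarith+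
    then show "1 / (2 + sqrt 2) \<ge> 0" "1 / (2 + sqrt 2) < (1::real)" "1 / (2 + sqrt 2) + 1 / (2 + sqrt 2) \<le> (1::real)"
      by (simp_all add: divide_less_eq divide_le_eq add_divide_distrib[symmetric])
  qed
  have 1: "\<exists>\<Lambda>. is_lattice \<Lambda> \<and> PI \<Lambda> = (1 / (2 + sqrt 2), 1 / (2 + sqrt 2))"
    by (rule exists_lattice_with_PI) (rule c)+
  have 2: "\<exists>\<Lambda>. is_lattice \<Lambda> \<and> PI \<Lambda> = (1 / 4, 1 / 4)" by (rule exists_lattice_with_PI) simp_all
  have 3: "PC \<infinity> 2 \<Lambda> = 1 / 4" if "is_lattice \<Lambda>" "PI \<Lambda> = (1 / 4, 1 / 4)" for \<Lambda>
    using PC_infinity_2_eq[OF that] by simp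
  have 4: "PC \<infinity> 6 \<Lambda> \<le> 1" if "is_lattice \<Lambda>" for \<Lambda>
    using PC_infinity_6[OF that surjective_pairing] PI_bounds[OF that surjective_pairing] by simp
  have 5: "PC \<infinity> 6 \<Lambda> = 1" if "square_lattice \<Lambda> \<or> rectangular_lattice \<Lambda>" for \<Lambda>
  proof -
    have "rectangular_lattice \<Lambda>" using that square_lattice_rectangular by blast
    note r = rectangular_lattice_PI[OF this]
    show ?thesis using PC_infinity_6[OF r(1) surjective_pairing] r(2) by simp
  qed
  have 6: "\<exists>\<Lambda>. rectangular_lattice \<Lambda>"
    using exists_square_lattice square_lattice_rectangular by blast
  have 7: "x \<in> {0..<1}" "y \<in> {0..1}" "x + y \<le> 1" if "is_lattice \<Lambda>" "PI \<Lambda> = (x, y)" for \<Lambda> x y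
    using PI_bounds[OF that] by simp_all
  show ?thesis
    unfolding Let_def
    by (intro conjI allI impI; (elim conjE)?; rule 1 2 3 4 5 6 7
        PC_2_2_eq PC_infinity_2_eq PC_ereal_4 PC_ereal_6 PC_infinity_4 PC_infinity_6
        PC_2_2_bound PC_infinity_2_bound PC_2_2_extremal PC_4_le_1 PC_4_hexagonal PC_6_less PC_6_limit
        exists_hexagonal_lattice exists_square_lattice; assumption)
qed

end
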